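(* Consider a classical solution $(\mathbf u,P,\tilde{\mathbf u},\tilde P,\eta,\tilde\eta)$ of the two-layer water wave problem in the equatorial $\beta$-plane approximation described in the context (the Euler equations and incompressibility in both layers, together with all kinematic and dynamic boundary conditions), and suppose that the velocity field satisfies $(u,v,w)\in L^\infty(D_\eta)^3$ and $(\tilde u,\tilde v,\tilde w)\in L^\infty(D_{\eta,\tilde\eta})^3$. (1) The flow has constant vorticity $\Omega$ in $D_\eta$ and constant vorticity $\tilde\Omega$ in $D_{\eta,\tilde\eta}$ (the two constant vectors being possibly different) if and only if, for all $x,y,z,t$ in the respective layers, $$u(x,y,z,t)=u(t),\quad v(x,y,z,t)=0,\quad w(x,y,z,t)=w(t),$$ $$\tilde u(x,y,z,t)=\tilde u(t),\quad \tilde v(x,y,z,t)=0,\quad \tilde w(x,y,z,t)=\tilde w(t),$$ that is, $u,\tilde u,w,\tilde w$ depend only on $t$, while $v$ and $\tilde v$ vanish. (2) If, in addition (to the flow having constant vorticity in each layer as in (1)), the bottom-defining function $b$ depends only on $y$, and $P$ and $\tilde P$ are bounded in $D_\eta$ and $D_{\eta,\tilde\eta}$, respectively, then $$u=\tilde u=-\frac{\omega R}{2}\quad\text{and}\quad v=w=\tilde v=\tilde w=0.$$ (3) If, moreover (in the situation of (2)), $\rho\neq\tilde\rho$, then $$\eta(x,y,t)=0\quad\text{for all } x,y,t,$$ and $$\tilde\eta(x,y,t)=-\frac{p\left(x+\frac{\omega R}{2}t,\,y\right)}{\tilde\rho g},$$ where $p$ is the given function prescribing the pressure on the free surface.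
   Context: Constants: $\omega=7.29\cdot 10^{-5}$ rad s$^{-1}$ (rotation speed of the Earth), $R=6378$ km (radius of the Earth), $g>0$ (gravitational acceleration), $\beta:=2\omega/R$, and constant densities $\rho>0$ (lower layer), $\tilde\rho>0$ (upper layer). The horizontal variables are $(x,y)\in\mathbb R^2$, $z$ is the vertical variable, and $t$ is time. Domain. The bottom is $z=b(x,y)$, where $b$ is a given differentiable function; the interface is $z=\eta(x,y,t)$ and the free surface is $z=\tilde\eta(x,y,t)$, both unknown, with $b<\eta<\tilde\eta$. The lower and upper layers are $$D_\eta=D_\eta(t)=\{(x,y,z): b(x,y)\le z\le\eta(x,y,t)\},\qquad D_{\eta,\tilde\eta}=D_{\eta,\tilde\eta}(t)=\{(x,y,z):\eta(x,y,t)\le z\le\tilde\eta(x,y,t)\}.$$ The velocity and pressure are $\mathbf u=(u,v,w)$, $P$ in $D_\eta$ and $\tilde{\mathbf u}=(\tilde u,\tilde v,\tilde w)$, $\tilde P$ in $D_{\eta,\tilde\eta}$; all are functions of $(x,y,z,t)$. All unknown functions are assumed to be smooth (classical solutions). Boundedness of velocities and pressures means boundedness in space over the respective layer at each time $t$. Equations in $D_\eta$: $$u_t+uu_x+vu_y+wu_z+2\omega w-\beta yv=-\tfrac{P_x}{\rho},$$ $$v_t+uv_x+vv_y+wv_z+\beta yu+\omega^2y=-\tfrac{P_y}{\rho},$$ $$w_t+uw_x+vw_y+ww_z-2\omega u-\omega^2R=-\tfrac{P_z}{\rho}-g,$$ $$u_x+v_y+w_z=0.$$ Equations in $D_{\eta,\tilde\eta}$: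 the same four equations with $(u,v,w,P,\rho)$ replaced by $(\tilde u,\tilde v,\tilde w,\tilde P,\tilde\rho)$. Boundary conditions, for all $x,y,t$: - free surface: $\tilde w=\tilde\eta_t+\tilde u\tilde\eta_x+\tilde v\tilde\eta_y$ on $z=\tilde\eta(x,y,t)$; - interface: $\tilde w=\eta_t+\tilde u\eta_x+\tilde v\eta_y$ and $w=\eta_t+u\eta_x+v\eta_y$ on $z=\eta(x,y,t)$; - bottom: $w=ub_x+vb_y$ on $z=b(x,y)$; - continuity of pressure at the interface: $P(x,y,\eta(x,y,t),t)=\tilde P(x,y,\eta(x,y,t),t)$; - dynamic condition: $\tilde P=p\left(x+\frac{\omega R}{2}t,y\right)$ on $z=\tilde\eta(x,y,t)$, where $(X,Y)\mapsto p(X,Y)$ is a given differentiable function. Vorticity: $$\Omega=(w_y-v_z,\;u_z-w_x,\;v_x-u_y)\ \text{in } D_\eta,\qquad \tilde\Omega=(\tilde w_y-\tilde v_z,\;\tilde u_z-\tilde w_x,\;\tilde v_x-\tilde u_y)\ \text{in } D_{\eta,\tilde\eta}.$$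
   Formalization: Parts (2) and (3) additionally assume that b is bounded; in (3) the formulas for η and η̃ are proved up to additive constants, and exactly as stated if P = −ρgz at some point of the lower layer and P̃ = −ρ̃gz at some point of the upper layer. Without these (2) and (3) are false. *)

theory Defs
  imports "HOL-Analysis.Analysis"
begin

(* Units: kilometre and second; the unit of mass is arbitrary. *)

definition earth_rotation :: real where
  "earth_rotation = 7.29 / 10 ^ 5"

definition earth_radius :: real where
  "earth_radius = 6378"

definition beta_param :: real where
  "beta_param = 2 * earth_rotation / earth_radius"


(* A space-time point is (x, y, z, t). *)
type_synonym spacetime = "real \<times> real \<times> real \<times> real"

(* A field on a layer is a total function of which only the values on the layer matter.
   Derivatives are therefore taken within the (closed) layer: in the interior they are the
   ordinary partial derivatives, on a boundary surface they are the derivatives from inside.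
   A layer lies between graphs of differentiable functions, one strictly below the other, so
   the Frechet derivative within it is unique at every point. *)
definition partial_in :: "'a::euclidean_space set \<Rightarrow> 'a \<Rightarrow> ('a \<Rightarrow> real) \<Rightarrow> 'a \<Rightarrow> real" where
  "partial_in S e f q = frechet_derivative f (at q within S) e"

abbreviation d_x :: "spacetime set \<Rightarrow> (spacetime \<Rightarrow> real) \<Rightarrow> spacetime \<Rightarrow> real" where
  "d_x S \<equiv> partial_in S (1, 0, 0, 0)"
abbreviation d_y :: "spacetime set \<Rightarrow> (spacetime \<Rightarrow> real) \<Rightarrow> spacetime \<Rightarrow> real" where
  "d_y S \<equiv> partial_in S (0, 1, 0, 0)"
abbreviation d_z :: "spacetime set \<Rightarrow> (spacetime \<Rightarrow> real) \<Rightarrow> spacetime \<Rightarrow> real" where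
  "d_z S \<equiv> partial_in S (0, 0, 1, 0)"
abbreviation d_t :: "spacetime set \<Rightarrow> (spacetime \<Rightarrow> real) \<Rightarrow> spacetime \<Rightarrow> real" where
  "d_t S \<equiv> partial_in S (0, 0, 0, 1)"

primrec Ck_on :: "nat \<Rightarrow> 'a::euclidean_space set \<Rightarrow> ('a \<Rightarrow> real) \<Rightarrow> bool" where
  "Ck_on 0 S f \<longleftrightarrow> continuous_on S f"
| "Ck_on (Suc k) S f \<longleftrightarrow> f differentiable_on S \<and> (\<forall>e. Ck_on k S (partial_in S e f))"

definition smooth_in :: "'a::euclidean_space set \<Rightarrow> ('a \<Rightarrow> real) \<Rightarrow> bool" where
  "smooth_in S f \<longleftrightarrow> (\<forall>k. Ck_on k S f)"


(* Surfaces are graphs over (x, y, t). *)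
definition layer :: "(real \<times> real \<times> real \<Rightarrow> real) \<Rightarrow> (real \<times> real \<times> real \<Rightarrow> real) \<Rightarrow> spacetime set" where
  "layer lo hi = {(x, y, z, t). lo (x, y, t) \<le> z \<and> z \<le> hi (x, y, t)}"

definition lower_layer :: "(real \<times> real \<Rightarrow> real) \<Rightarrow> (real \<times> real \<times> real \<Rightarrow> real) \<Rightarrow> spacetime set" where
  "lower_layer b \<eta> = layer (\<lambda>(x, y, t). b (x, y)) \<eta>"

definition upper_layer :: "(real \<times> real \<times> real \<Rightarrow> real) \<Rightarrow> (real \<times> real \<times> real \<Rightarrow> real) \<Rightarrow> spacetime set" where
  "upper_layer \<eta> \<eta>' = layer \<eta> \<eta>'"

(* Bounded in space at each time, the bound may depend on the time. *)
definition bounded_in_space :: "spacetime set \<Rightarrow> (spacetime \<Rightarrow> real) \<Rightarrow> bool" where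
  "bounded_in_space S f \<longleftrightarrow> (\<forall>t. bounded {f (x, y, z, t) | x y z. (x, y, z, t) \<in> S})"


definition euler_equations ::
  "real \<Rightarrow> real \<Rightarrow> spacetime set \<Rightarrow> (spacetime \<Rightarrow> real) \<Rightarrow> (spacetime \<Rightarrow> real) \<Rightarrow>
   (spacetime \<Rightarrow> real) \<Rightarrow> (spacetime \<Rightarrow> real) \<Rightarrow> bool" where
  "euler_equations g \<rho> S u v w P \<longleftrightarrow>
    (\<forall>x y z t. (x, y, z, t) \<in> S \<longrightarrow>
      (let q = (x, y, z, t) in
        d_t S u q + u q * d_x S u q + v q * d_y S u q + w q * d_z S u q
          + 2 * earth_rotation * w q - beta_param * y * v q
          = - (d_x S P q / \<rho>) \<and>
        d_t S v q + u q * d_x S v q + v q * d_y S v q + w q * d_z S v q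
          + beta_param * y * u q + earth_rotation\<^sup>2 * y
          = - (d_y S P q / \<rho>) \<and>
        d_t S w q + u q * d_x S w q + v q * d_y S w q + w q * d_z S w q
          - 2 * earth_rotation * u q - earth_rotation\<^sup>2 * earth_radius
          = - (d_z S P q / \<rho>) - g \<and>
        d_x S u q + d_y S v q + d_z S w q = 0))"

definition vorticity ::
  "spacetime set \<Rightarrow> (spacetime \<Rightarrow> real) \<Rightarrow> (spacetime \<Rightarrow> real) \<Rightarrow> (spacetime \<Rightarrow> real) \<Rightarrow>
   spacetime \<Rightarrow> real \<times> real \<times> real" where
  "vorticity S u v w q =
    (d_y S w q - d_z S v q, d_z S u q - d_x S w q, d_x S v q - d_y S u q)"

definition constant_vorticity ::
  "spacetime set \<Rightarrow> (spacetime \<Rightarrow> real) \<Rightarrow> (spacetime \<Rightarrow> real) \<Rightarrow> (spacetime \<Rightarrow> real) \<Rightarrow> bool" where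
  "constant_vorticity S u v w \<longleftrightarrow> (\<exists>\<Omega>. \<forall>q\<in>S. vorticity S u v w q = \<Omega>)"

(* The kinematic condition w = h_t + u h_x + v h_y on the surface z = h(x, y, t). *)
definition kinematic_condition ::
  "(real \<times> real \<times> real \<Rightarrow> real) \<Rightarrow> (spacetime \<Rightarrow> real) \<Rightarrow> (spacetime \<Rightarrow> real) \<Rightarrow>
   (spacetime \<Rightarrow> real) \<Rightarrow> bool" where
  "kinematic_condition h u v w \<longleftrightarrow>
    (\<forall>x y t. let q = (x, y, h (x, y, t), t) in
      w q = partial_in UNIV (0, 0, 1) h (x, y, t)
            + u q * partial_in UNIV (1, 0, 0) h (x, y, t)
            + v q * partial_in UNIV (0, 1, 0) h (x, y, t))"

definition bottom_condition ::
  "(real \<times> real \<Rightarrow> real) \<Rightarrow> (spacetime \<Rightarrow> real) \<Rightarrow> (spacetime \<Rightarrow> real) \<Rightarrow> (spacetime \<Rightarrow> real) \<Rightarrow> bool" where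
  "bottom_condition b u v w \<longleftrightarrow>
    (\<forall>x y t. let q = (x, y, b (x, y), t) in
      w q = u q * partial_in UNIV (1, 0) b (x, y) + v q * partial_in UNIV (0, 1) b (x, y))"

(* Index 1 is the lower layer and the interface, index 2 the upper layer and the free surface
   (the quantities with a tilde). *)
definition two_layer_solution ::
  "real \<Rightarrow> real \<Rightarrow> real \<Rightarrow> (real \<times> real \<Rightarrow> real) \<Rightarrow> (real \<times> real \<Rightarrow> real) \<Rightarrow>
   (spacetime \<Rightarrow> real) \<Rightarrow> (spacetime \<Rightarrow> real) \<Rightarrow> (spacetime \<Rightarrow> real) \<Rightarrow> (spacetime \<Rightarrow> real) \<Rightarrow>
   (spacetime \<Rightarrow> real) \<Rightarrow> (spacetime \<Rightarrow> real) \<Rightarrow> (spacetime \<Rightarrow> real) \<Rightarrow> (spacetime \<Rightarrow> real) \<Rightarrow>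
   (real \<times> real \<times> real \<Rightarrow> real) \<Rightarrow> (real \<times> real \<times> real \<Rightarrow> real) \<Rightarrow> bool" where
  "two_layer_solution g \<rho>\<^sub>1 \<rho>\<^sub>2 b p u\<^sub>1 v\<^sub>1 w\<^sub>1 P\<^sub>1 u\<^sub>2 v\<^sub>2 w\<^sub>2 P\<^sub>2 \<eta>\<^sub>1 \<eta>\<^sub>2 \<longleftrightarrow>
    smooth_in UNIV \<eta>\<^sub>1 \<and> smooth_in UNIV \<eta>\<^sub>2 \<and>
    (\<forall>x y t. b (x, y) < \<eta>\<^sub>1 (x, y, t) \<and> \<eta>\<^sub>1 (x, y, t) < \<eta>\<^sub>2 (x, y, t)) \<and>
    (\<forall>f \<in> {u\<^sub>1, v\<^sub>1, w\<^sub>1, P\<^sub>1}. smooth_in (lower_layer b \<eta>\<^sub>1) f) \<and>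
    (\<forall>f \<in> {u\<^sub>2, v\<^sub>2, w\<^sub>2, P\<^sub>2}. smooth_in (upper_layer \<eta>\<^sub>1 \<eta>\<^sub>2) f) \<and>
    euler_equations g \<rho>\<^sub>1 (lower_layer b \<eta>\<^sub>1) u\<^sub>1 v\<^sub>1 w\<^sub>1 P\<^sub>1 \<and>
    euler_equations g \<rho>\<^sub>2 (upper_layer \<eta>\<^sub>1 \<eta>\<^sub>2) u\<^sub>2 v\<^sub>2 w\<^sub>2 P\<^sub>2 \<and>
    kinematic_condition \<eta>\<^sub>2 u\<^sub>2 v\<^sub>2 w\<^sub>2 \<and>
    kinematic_condition \<eta>\<^sub>1 u\<^sub>2 v\<^sub>2 w\<^sub>2 \<and>
    kinematic_condition \<eta>\<^sub>1 u\<^sub>1 v\<^sub>1 w\<^sub>1 \<and>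
    bottom_condition b u\<^sub>1 v\<^sub>1 w\<^sub>1 \<and>
    (\<forall>x y t. P\<^sub>1 (x, y, \<eta>\<^sub>1 (x, y, t), t) = P\<^sub>2 (x, y, \<eta>\<^sub>1 (x, y, t), t)) \<and>
    (\<forall>x y t. P\<^sub>2 (x, y, \<eta>\<^sub>2 (x, y, t), t)
              = p (x + earth_rotation * earth_radius / 2 * t, y))"

(* The equations are invariant under shifts of z and determine the pressure only up to a
   constant of integration.  This fixes the constant: the hydrostatic law P = - \<rho> g z, with
   the reference value P = 0 at z = 0, holds in at least one point of the layer. *)
definition pressure_normalized ::
  "real \<Rightarrow> real \<Rightarrow> spacetime set \<Rightarrow> (spacetime \<Rightarrow> real) \<Rightarrow> bool" where
  "pressure_normalized g \<rho> S P \<longleftrightarrow>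
    (\<exists>x y z t. (x, y, z, t) \<in> S \<and> P (x, y, z, t) = - \<rho> * g * z)"

end

theory Submission
  imports Defs
begin

text \<open>In a layer of constant vorticity the velocity components are harmonic at each time, and the
  curl of the Euler equations is a first-order system whose only variable coefficient is linear
  in y. Applying the Laplacian to it annihilates the mixed yz-derivatives of the velocity, and then
  all second derivatives of w and all derivatives of v except the constant one along y. Boundedness
  removes the remaining linear terms of v and w, after which the curl equations force the vorticity
  to vanish.

  The pressure is then an explicit polynomial in x, y, z at each time. Its boundedness along a
  bounded surface fixes u, first in the lower layer (along the bottom), which bounds the interface,
  and then in the upper layer (along the interface). With this u the pressure is hydrostatic and
  both surfaces are travelling waves, so that continuity of the pressure determines their
  shape.\<close>

section \<open>Calculus of partial derivatives on open sets\<close>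

text \<open>A bounded harmonic function on a layer need not be constant: a layer has finite height
  above each point, and Liouville's theorem fails there. The curl equations must therefore first
  turn v and w into polynomials on each time slice; only then does boundedness over the whole
  horizontal plane act, on the coefficients. The algebra succeeds because the Coriolis coefficient
  has the nonzero slope \<open>beta_param\<close> in y: differentiating this coefficient produces
  exactly the terms that get isolated.

  The heights of the surfaces are not known to be bounded beforehand, so a summand e * z evaluated
  on a surface is harmless only if e = 0 or if that surface is bounded. This dictates the order of
  the arguments: v before w, and the lower layer before the upper one. It is also where boundedness
  of b enters, since along the bottom a term e * b(y) with b growing like y^2 could compensate the
  quadratic term of the pressure.

  The equations see only the pressure gradient, so each hydrostatic pressure carries an unknown
  function of time. The dynamic condition makes the one of the upper layer constant.\<close>

lemma has_derivative_within_cong_on: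
  fixes f g :: "'a::euclidean_space \<Rightarrow> real"
  assumes "\<And>x. x \<in> S \<Longrightarrow> f x = g x" and "q \<in> S"
  shows "(f has_derivative f') (at q within S) \<longleftrightarrow> (g has_derivative f') (at q within S)"
  using assms has_derivative_transform[of q S f g f'] has_derivative_transform[of q S g f f'] by auto

text \<open>\<open>frechet_derivative\<close> is a choice from the predicate
  \<open>has_derivative\<close>. Functions that agree on S satisfy the same predicate, hence the
  same choice is made, with no appeal to uniqueness of derivatives or to differentiability.\<close>

lemma partial_in_cong:
  assumes "\<And>x. x \<in> S \<Longrightarrow> f x = g x" and "q \<in> S"
  shows "partial_in S e f q = partial_in S e g q"
  using has_derivative_within_cong_on[OF assms] by (simp add: partial_in_def frechet_derivative_def)

lemma Ck_on_cong:
  assumes "Ck_on k S f" and "\<And>x. x \<in> S \<Longrightarrow> f x = g x"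
  shows "Ck_on k S g"
  using assms
proof (induction k arbitrary: f g)
  case 0
  then show ?case
    using continuous_on_cong[of S S f g] by simp
next
  case (Suc k)
  then have "g differentiable_on S"
    using differentiable_transform_within[of f _ S 1 g]
    by (auto simp: differentiable_on_def)
  moreover have "Ck_on k S (partial_in S e g)" for e
    using Suc.IH[of "partial_in S e f"] Suc.prems partial_in_cong[of S f g] by simp
  ultimately show ?case
    by simp
qed

section \<open>Restriction to open subsets\<close>

lemma partial_in_open_subset:
  assumes "open G" and "G \<subseteq> S" and "q \<in> G"
  shows "partial_in S e f q = partial_in G e f q"
proof -
  have "q \<in> interior S"
    using assms by (meson interior_maximal subsetD)
  then show ?thesis
    unfolding partial_in_def by (metis assms(1,3) at_within_interior at_within_open)
qed

lemma Ck_on_open_subset: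
  assumes "Ck_on k S f" and "open G" and "G \<subseteq> S"
  shows "Ck_on k G f"
  using assms(1)
proof (induction k arbitrary: f)
  case 0
  then show ?case
    using assms continuous_on_subset by auto
next
  case (Suc k)
  then have "Ck_on k G (partial_in G e f)" for e
    using Ck_on_cong[of k G "partial_in S e f"] partial_in_open_subset[OF assms(2,3)] by simp
  then show ?case
    using Suc.prems assms(3) differentiable_on_subset by auto
qed

lemma smooth_in_open_subset:
  "smooth_in S f \<Longrightarrow> open G \<Longrightarrow> G \<subseteq> S \<Longrightarrow> smooth_in G f"
  by (auto simp: smooth_in_def intro: Ck_on_open_subset)

lemma smooth_in_partial: "smooth_in S f \<Longrightarrow> smooth_in S (partial_in S e f)"
  unfolding smooth_in_def by (metis Ck_on.simps(2))

lemma smooth_in_continuous_on: "smooth_in S f \<Longrightarrow> continuous_on S f"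
  unfolding smooth_in_def by (metis Ck_on.simps(1))

lemma smooth_in_differentiable_on: "smooth_in S f \<Longrightarrow> f differentiable_on S"
  unfolding smooth_in_def by (metis Ck_on.simps(2))

lemma differentiable_on_has_derivative_partial:
  assumes "f differentiable_on G" and "open G" and "q \<in> G"
  shows "(f has_derivative (\<lambda>e. partial_in G e f q)) (at q)"
proof -
  have "at q within G = at q"
    using assms(2,3) by (rule at_within_open[rotated])
  then show ?thesis
    using assms(1,3) unfolding differentiable_on_def partial_in_def by (metis frechet_derivative_works)
qed

text \<open>The chain rule along a line; it makes one-dimensional results such as the mean value
  theorem available for \<open>partial_in\<close>.\<close>

lemma DERIV_along_line:
  assumes "f differentiable_on G" and "open G" and "q + s *\<^sub>R e \<in> G"
  shows "((\<lambda>s. f (q + s *\<^sub>R e)) has_real_derivative partial_in G e f (q + s *\<^sub>R e)) (at s)"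
proof -
  have f: "(f has_derivative (\<lambda>e'. partial_in G e' f (q + s *\<^sub>R e))) (at (q + s *\<^sub>R e))"
    using differentiable_on_has_derivative_partial[OF assms] .
  have l: "((\<lambda>s. q + s *\<^sub>R e) has_derivative (\<lambda>h. h *\<^sub>R e)) (at s)"
    by (auto intro!: derivative_eq_intros)
  have "((\<lambda>s. f (q + s *\<^sub>R e)) has_derivative (\<lambda>h. partial_in G (h *\<^sub>R e) f (q + s *\<^sub>R e))) (at s)"
    using diff_chain_at[OF l f] by (simp add: o_def)
  moreover have "partial_in G (h *\<^sub>R e) f (q + s *\<^sub>R e) = partial_in G e f (q + s *\<^sub>R e) * h" for h
    using linear_scale[OF has_derivative_linear[OF f]] by simp
  ultimately show ?thesis
    by (simp add: has_field_derivative_def)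
qed

text \<open>The mean value theorem is used twice: for the increment k of f between two parallel
  segments, and then for the derivative of f along e in the direction e'.\<close>

lemma second_difference_mean_value:
  fixes f :: "'a::euclidean_space \<Rightarrow> real"
  assumes "open G" and "f differentiable_on G" and "partial_in G e f differentiable_on G" and "0 < h"
    and G: "\<And>a c. 0 \<le> a \<Longrightarrow> a \<le> h \<Longrightarrow> 0 \<le> c \<Longrightarrow> c \<le> h \<Longrightarrow> q + a *\<^sub>R e + c *\<^sub>R e' \<in> G"
  obtains a c where "0 \<le> a" "a \<le> h" "0 \<le> c" "c \<le> h"
    "f (q + h *\<^sub>R e + h *\<^sub>R e') - f (q + h *\<^sub>R e) - f (q + h *\<^sub>R e') + f q
      = h\<^sup>2 * partial_in G e' (partial_in G e f) (q + a *\<^sub>R e + c *\<^sub>R e')"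
proof -
  define k where "k s = f ((q + h *\<^sub>R e') + s *\<^sub>R e) - f (q + s *\<^sub>R e)" for s
  have "(k has_real_derivative partial_in G e f ((q + h *\<^sub>R e') + s *\<^sub>R e) - partial_in G e f (q + s *\<^sub>R e)) (at s)"
    if "0 \<le> s" "s \<le> h" for s
    unfolding k_def using G[of s h] G[of s 0] that assms
    by (intro DERIV_diff DERIV_along_line) (auto simp: algebra_simps)
  from MVT2[OF \<open>0 < h\<close> this] obtain a where a: "0 < a" "a < h"
    and ka: "k h - k 0 = h * (partial_in G e f ((q + h *\<^sub>R e') + a *\<^sub>R e) - partial_in G e f (q + a *\<^sub>R e))"
    by auto
  have "((\<lambda>s. partial_in G e f ((q + a *\<^sub>R e) + s *\<^sub>R e')) has_real_derivative
      partial_in G e' (partial_in G e f) ((q + a *\<^sub>R e) + s *\<^sub>R e')) (at s)"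
    if "0 \<le> s" "s \<le> h" for s
    using G[of a s] that assms a by (intro DERIV_along_line) auto
  from MVT2[OF \<open>0 < h\<close> this] obtain c where c: "0 < c" "c < h"
    and "partial_in G e f ((q + a *\<^sub>R e) + h *\<^sub>R e') - partial_in G e f (q + a *\<^sub>R e)
      = h * partial_in G e' (partial_in G e f) ((q + a *\<^sub>R e) + c *\<^sub>R e')"
    by auto
  with ka have "k h - k 0 = h\<^sup>2 * partial_in G e' (partial_in G e f) (q + a *\<^sub>R e + c *\<^sub>R e')"
    by (simp add: power2_eq_square add_ac)
  moreover have "k h - k 0 = f (q + h *\<^sub>R e + h *\<^sub>R e') - f (q + h *\<^sub>R e) - f (q + h *\<^sub>R e') + f q"
    by (simp add: k_def add_ac)
  ultimately show thesis
    using that[of a c] a c by simp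
qed

text \<open>Schwarz's theorem. The second difference is symmetric in e and e', so both mixed
  derivatives take a common value at points arbitrarily close to q, and continuity transfers the
  equality to q.\<close>

lemma partial_in_commute:
  assumes "smooth_in G f" and "open G" and "q \<in> G"
  shows "partial_in G e (partial_in G e' f) q = partial_in G e' (partial_in G e f) q"
proof (rule ccontr)
  let ?A = "partial_in G e' (partial_in G e f)" and ?B = "partial_in G e (partial_in G e' f)"
  assume "?B q \<noteq> ?A q"
  \<comment> \<open>Half the gap: a common value cannot be closer than this to both
    \<open>?A q\<close> and \<open>?B q\<close>.\<close>
  define \<epsilon> where "\<epsilon> = \<bar>?A q - ?B q\<bar> / 2"
  have "\<epsilon> > 0"
    using \<open>?B q \<noteq> ?A q\<close> by (simp add: \<epsilon>_def)
  have sm: "smooth_in G (partial_in G e f)" "smooth_in G (partial_in G e' f)"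
    using assms smooth_in_partial by auto
  then have dif: "f differentiable_on G" "partial_in G e f differentiable_on G"
      "partial_in G e' f differentiable_on G"
    using assms smooth_in_differentiable_on by auto
  have "isCont ?A q" "isCont ?B q"
    using smooth_in_continuous_on[OF smooth_in_partial[OF sm(1)]] assms
      smooth_in_continuous_on[OF smooth_in_partial[OF sm(2)]]
    by (simp_all add: continuous_on_eq_continuous_at)
  then obtain d1 d2 where d: "d1 > 0" "d2 > 0"
    and d1: "\<And>x. dist x q < d1 \<Longrightarrow> dist (?A x) (?A q) < \<epsilon>"
    and d2: "\<And>x. dist x q < d2 \<Longrightarrow> dist (?B x) (?B q) < \<epsilon>"
    using \<open>\<epsilon> > 0\<close> unfolding continuous_at_eps_delta by metis
  obtain d3 where d3: "d3 > 0" "ball q d3 \<subseteq> G"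
    using assms open_contains_ball by blast
  define r where "r = min d1 (min d2 d3)"
  have "r > 0"
    using d d3 by (simp add: r_def)
  \<comment> \<open>Keeps the whole parallelogram within distance r / 2 of q; the summand 1 covers
    the case of two zero directions.\<close>
  define h where "h = r / (2 * (norm e + norm e' + 1))"
  have pos: "norm e + norm e' + 1 > 0"
    by (simp add: add_nonneg_pos)
  have "h > 0"
    using pos \<open>r > 0\<close> by (simp add: h_def)
  have near: "dist (q + a *\<^sub>R e + c *\<^sub>R e') q < r" if "0 \<le> a" "a \<le> h" "0 \<le> c" "c \<le> h" for a c
  proof -
    have "dist (q + a *\<^sub>R e + c *\<^sub>R e') q = norm (a *\<^sub>R e + c *\<^sub>R e')"
      by (simp add: dist_norm add.assoc)
    also have "\<dots> \<le> a * norm e + c * norm e'"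
      using norm_triangle_ineq[of "a *\<^sub>R e" "c *\<^sub>R e'"] that by simp
    also have "\<dots> \<le> h * norm e + h * norm e'"
      using that by (intro add_mono mult_right_mono) auto
    also have "\<dots> \<le> h * (norm e + norm e' + 1)"
      using \<open>h > 0\<close> by (simp add: algebra_simps)
    also have "\<dots> = r / 2"
      using pos by (simp add: h_def field_simps)
    finally show ?thesis
      using \<open>r > 0\<close> by simp
  qed
  then have G: "q + a *\<^sub>R e + c *\<^sub>R e' \<in> G" if "0 \<le> a" "a \<le> h" "0 \<le> c" "c \<le> h" for a c
    using near[OF that] d3(2) by (auto simp: r_def dist_commute)
  obtain a c where ac: "0 \<le> a" "a \<le> h" "0 \<le> c" "c \<le> h"
    "f (q + h *\<^sub>R e + h *\<^sub>R e') - f (q + h *\<^sub>R e) - f (q + h *\<^sub>R e') + f q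
      = h\<^sup>2 * ?A (q + a *\<^sub>R e + c *\<^sub>R e')"
    using second_difference_mean_value[OF assms(2) dif(1,2) \<open>h > 0\<close> G] by blast
  have G': "q + a *\<^sub>R e' + c *\<^sub>R e \<in> G" if "0 \<le> a" "a \<le> h" "0 \<le> c" "c \<le> h" for a c
    using G[of c a] that by (simp add: add_ac)
  obtain a' c' where ac': "0 \<le> a'" "a' \<le> h" "0 \<le> c'" "c' \<le> h"
    "f (q + h *\<^sub>R e' + h *\<^sub>R e) - f (q + h *\<^sub>R e') - f (q + h *\<^sub>R e) + f q
      = h\<^sup>2 * ?B (q + a' *\<^sub>R e' + c' *\<^sub>R e)"
    using second_difference_mean_value[OF assms(2) dif(1,3) \<open>h > 0\<close> G'] by blast
  have swap: "q + s *\<^sub>R e' + s' *\<^sub>R e = q + s' *\<^sub>R e + s *\<^sub>R e'" for s s'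
    by (simp add: add_ac)
  have "h\<^sup>2 * ?A (q + a *\<^sub>R e + c *\<^sub>R e') = h\<^sup>2 * ?B (q + c' *\<^sub>R e + a' *\<^sub>R e')"
    using ac(5) ac'(5) unfolding swap by linarith
  then have "?A (q + a *\<^sub>R e + c *\<^sub>R e') = ?B (q + c' *\<^sub>R e + a' *\<^sub>R e')"
    using \<open>h > 0\<close> by simp
  moreover have "dist (?A (q + a *\<^sub>R e + c *\<^sub>R e')) (?A q) < \<epsilon>"
    using near[of a c] ac by (intro d1) (simp add: r_def)
  moreover have "dist (?B (q + c' *\<^sub>R e + a' *\<^sub>R e')) (?B q) < \<epsilon>"
    using near[of c' a'] ac' by (intro d2) (simp add: r_def)
  ultimately show False
    unfolding dist_real_def \<epsilon>_def by argo
qed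

section \<open>The vorticity equations\<close>

text \<open>A relation instead of an operator: the derivative of a composite expression is built by
  introduction rules, and its value need not be known in advance nor the expression be shown
  smooth.\<close>

definition deriv_along :: "'a::euclidean_space \<Rightarrow> ('a \<Rightarrow> real) \<Rightarrow> 'a \<Rightarrow> real \<Rightarrow> bool" where
  "deriv_along e f q d \<longleftrightarrow> ((\<lambda>s. f (q + s *\<^sub>R e)) has_real_derivative d) (at 0)"

lemma deriv_along_const: "deriv_along e (\<lambda>q. c) q 0"
  by (simp add: deriv_along_def)

lemma deriv_along_add:
  "deriv_along e f q a \<Longrightarrow> deriv_along e h q b \<Longrightarrow> deriv_along e (\<lambda>q. f q + h q) q (a + b)"
  unfolding deriv_along_def by (rule DERIV_add)

lemma deriv_along_diff:
  "deriv_along e f q a \<Longrightarrow> deriv_along e h q b \<Longrightarrow> deriv_along e (\<lambda>q. f q - h q) q (a - b)"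
  unfolding deriv_along_def by (rule DERIV_diff)

lemma deriv_along_cmult: "deriv_along e f q a \<Longrightarrow> deriv_along e (\<lambda>q. c * f q) q (c * a)"
  unfolding deriv_along_def by (rule DERIV_cmult)

lemma deriv_along_mult:
  "deriv_along e f q a \<Longrightarrow> deriv_along e h q b \<Longrightarrow> deriv_along e (\<lambda>q. f q * h q) q (a * h q + f q * b)"
  unfolding deriv_along_def using DERIV_mult'[of "\<lambda>s. f (q + s *\<^sub>R e)" a 0 UNIV "\<lambda>s. h (q + s *\<^sub>R e)" b]
  by (simp add: add.commute)

lemma deriv_along_cdivide: "deriv_along e f q a \<Longrightarrow> deriv_along e (\<lambda>q. f q / c) q (a / c)"
  unfolding deriv_along_def by (rule DERIV_cdivide)

lemma deriv_along_snd: "deriv_along e (\<lambda>q. fst (snd q)) q (fst (snd e))"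
  unfolding deriv_along_def by (auto intro!: derivative_eq_intros)

lemma deriv_along_smooth:
  "smooth_in G f \<Longrightarrow> open G \<Longrightarrow> q \<in> G \<Longrightarrow> deriv_along e f q (partial_in G e f q)"
  unfolding deriv_along_def using DERIV_along_line[of f G q 0 e] smooth_in_differentiable_on by auto

lemmas deriv_along_intros = deriv_along_const deriv_along_snd deriv_along_add deriv_along_diff
  deriv_along_cmult deriv_along_cdivide deriv_along_mult deriv_along_smooth smooth_in_partial

text \<open>Allows an identity on an open set to be differentiated: the rules
  \<open>deriv_along_intros\<close> compute d from the left-hand side, and f agrees with 0 near q
  along the line.\<close>

lemma deriv_along_zero:
  assumes "deriv_along e f q d" and "open G" and "q \<in> G" and "\<And>q. q \<in> G \<Longrightarrow> f q = 0"
  shows "d = 0"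
proof -
  have "open {s. q + s *\<^sub>R e \<in> G}"
    using open_vimage[OF \<open>open G\<close>, of "\<lambda>s. q + s *\<^sub>R e"] by (simp add: vimage_def continuous_intros)
  then have "\<forall>\<^sub>F s in nhds 0. q + s *\<^sub>R e \<in> G"
    using \<open>q \<in> G\<close> eventually_nhds_in_open[of "{s. q + s *\<^sub>R e \<in> G}" 0] by simp
  then have "\<forall>\<^sub>F s in nhds 0. f (q + s *\<^sub>R e) = 0"
    by eventually_elim (use assms(4) in simp)
  then have "((\<lambda>s. 0) has_real_derivative d) (at 0)"
    using assms(1) DERIV_cong_ev[OF refl _ refl, of "\<lambda>s. f (q + s *\<^sub>R e)" "\<lambda>s. 0" 0 d]
    unfolding deriv_along_def by simp
  then show ?thesis
    by (metis DERIV_const DERIV_unique)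
qed

lemma partial_in_eq_zero:
  assumes "smooth_in G f" and "open G" and "q \<in> G" and "\<And>q. q \<in> G \<Longrightarrow> f q = c"
  shows "partial_in G e f q = 0"
  using deriv_along_zero[OF deriv_along_diff[OF deriv_along_smooth[OF assms(1-3), of e] deriv_along_const[of e c]]
      assms(2,3)] assms(4)
  by simp

text \<open>Moves the innermost direction to the outside, so that pure second derivatives of a first
  derivative become derivatives of the summands of the Laplacian.\<close>

lemma partial_in_commute2:
  assumes "smooth_in G f" and "open G" and "q \<in> G"
  shows "partial_in G e (partial_in G e' (partial_in G a f)) q
    = partial_in G a (partial_in G e (partial_in G e' f)) q"
proof -
  have "partial_in G e (partial_in G e' (partial_in G a f)) q
      = partial_in G e (partial_in G a (partial_in G e' f)) q"
    using assms by (intro partial_in_cong) (simp_all add: partial_in_commute)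
  also have "\<dots> = partial_in G a (partial_in G e (partial_in G e' f)) q"
    using assms by (intro partial_in_commute smooth_in_partial) auto
  finally show ?thesis .
qed

text \<open>The Laplacian is the spatial one; time is only a parameter.\<close>

definition harmonic :: "spacetime set \<Rightarrow> (spacetime \<Rightarrow> real) \<Rightarrow> bool" where
  "harmonic G f \<longleftrightarrow> (\<forall>q\<in>G. d_x G (d_x G f) q + d_y G (d_y G f) q + d_z G (d_z G f) q = 0)"

text \<open>The Laplacian commutes with the constant coefficients, so it only sees the coefficient
  that is linear in y, and what is left of it is twice a mixed derivative.\<close>
lemma harmonic_transport_mixed_zero:
  assumes "open G" and sm: "smooth_in G f" "smooth_in G h"
    and harm: "harmonic G f" "harmonic G h" and "\<beta> \<noteq> 0"
    and eq: "\<And>q. q \<in> G \<Longrightarrow>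
      a * d_x G f q + b * d_y G f q + (c + \<beta> * fst (snd q)) * d_z G f q - k * h q = 0"
    and "q \<in> G"
  shows "d_y G (d_z G f) q = 0"
proof -
  let ?D = "partial_in G" and ?y = "\<lambda>q :: spacetime. fst (snd q)"
  \<comment> \<open>Stated literally as the derivative rules produce it:
    \<open>0 + \<beta> * fst (snd e)\<close> is the derivative of the coefficient
    \<open>c + \<beta> * y\<close>.\<close>
  have d1: "a * ?D e (d_x G f) q + b * ?D e (d_y G f) q
      + ((0 + \<beta> * fst (snd e)) * d_z G f q + (c + \<beta> * ?y q) * ?D e (d_z G f) q) - k * ?D e h q = 0"
    if "q \<in> G" for q e
    by (rule deriv_along_zero[where e = e, OF _ \<open>open G\<close> that eq];
        (assumption | intro deriv_along_intros assms that))
  have d2: "a * ?D e (?D e (d_x G f)) q + b * ?D e (?D e (d_y G f)) q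
      + ((0 + \<beta> * fst (snd e)) * ?D e (d_z G f) q
        + ((0 + \<beta> * fst (snd e)) * ?D e (d_z G f) q + (c + \<beta> * ?y q) * ?D e (?D e (d_z G f)) q))
      - k * ?D e (?D e h) q = 0"
    for e
    by (rule deriv_along_zero[where e = e, OF _ \<open>open G\<close> \<open>q \<in> G\<close> d1[where e = e]];
        (assumption | intro deriv_along_intros assms))
  have lap: "?D e (d_x G (d_x G f)) q + ?D e (d_y G (d_y G f)) q + ?D e (d_z G (d_z G f)) q = 0" for e
    by (rule deriv_along_zero[where e = e, OF _ \<open>open G\<close> \<open>q \<in> G\<close> harm(1)[unfolded harmonic_def, rule_format]];
        (assumption | intro deriv_along_intros assms))
  have laph: "d_x G (d_x G h) q + d_y G (d_y G h) q + d_z G (d_z G h) q = 0"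
    using harm(2) \<open>q \<in> G\<close> by (simp add: harmonic_def)
  note comm = partial_in_commute2[OF sm(1) \<open>open G\<close> \<open>q \<in> G\<close>]
  let ?X = "(1, 0, 0, 0) :: spacetime" and ?Y = "(0, 1, 0, 0) :: spacetime"
    and ?Z = "(0, 0, 1, 0) :: spacetime"
  \<comment> \<open>\<open>d2\<close> is summed over the three directions. Multiplying
    \<open>lap\<close> and \<open>laph\<close> by the coefficients beforehand leaves a linear
    problem, and the cross term of the product rule survives only in the direction y.\<close>
  have "2 * (\<beta> * d_y G (d_z G f) q) = 0"
    using d2[of ?X] d2[of ?Y] d2[of ?Z] arg_cong[OF lap[of ?X], of "(*) a"]
      arg_cong[OF lap[of ?Y], of "(*) b"] arg_cong[OF lap[of ?Z], of "(*) (c + \<beta> * fst (snd q))"]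
      arg_cong[OF laph, of "(*) k"]
    unfolding comm[of ?X ?X ?Y] comm[of ?X ?X ?Z] comm[of ?Y ?Y ?X] comm[of ?Y ?Y ?Z]
      comm[of ?Z ?Z ?X] comm[of ?Z ?Z ?Y]
      fst_conv snd_conv mult_zero_left mult_zero_right mult_1_right add_0_left add_0_right
      distrib_left distrib_right
    by linarith
  then show ?thesis
    using \<open>\<beta> \<noteq> 0\<close> by simp
qed

text \<open>The term l collects the Coriolis and centrifugal terms, a is the direction of the momentum
  component f.\<close>
lemma momentum_equation_derivative:
  assumes "open G" and sm: "smooth_in G u" "smooth_in G v" "smooth_in G w" "smooth_in G P" "smooth_in G f"
    and eq: "\<And>q. q \<in> G \<Longrightarrow>
      d_t G f q + u q * d_x G f q + v q * d_y G f q + w q * d_z G f q + l q + partial_in G a P q / \<rho> = 0"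
    and "q \<in> G" and "deriv_along e l q l'"
  shows "d_t G (partial_in G e f) q
    + (partial_in G e u q * d_x G f q + u q * d_x G (partial_in G e f) q)
    + (partial_in G e v q * d_y G f q + v q * d_y G (partial_in G e f) q)
    + (partial_in G e w q * d_z G f q + w q * d_z G (partial_in G e f) q)
    + l' + partial_in G e (partial_in G a P) q / \<rho> = 0"
proof -
  \<comment> \<open>In the conclusion e is the innermost direction, the form in which the vorticity
    relations can replace \<open>partial_in G e f\<close>.\<close>
  note comm = partial_in_commute[OF sm(5) \<open>open G\<close> \<open>q \<in> G\<close>, of _ e]
  show ?thesis
    unfolding comm
    by (rule deriv_along_zero[where e = e, OF _ \<open>open G\<close> \<open>q \<in> G\<close> eq];
        (assumption | intro deriv_along_intros assms))
qed

lemma constant_vorticity_second_derivatives: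
  assumes "open G" and sm: "smooth_in G u" "smooth_in G v" "smooth_in G w"
    and vort: "\<forall>q\<in>G. vorticity G u v w q = (\<Omega>\<^sub>1, \<Omega>\<^sub>2, \<Omega>\<^sub>3)"
    and "q \<in> G"
  shows "partial_in G e (d_y G w) q = partial_in G e (d_z G v) q"
    and "partial_in G e (d_x G w) q = partial_in G e (d_z G u) q"
    and "partial_in G e (d_x G v) q = partial_in G e (d_y G u) q"
proof -
  have V: "d_y G w q - d_z G v q - \<Omega>\<^sub>1 = 0" "d_x G w q - d_z G u q + \<Omega>\<^sub>2 = 0"
    "d_x G v q - d_y G u q - \<Omega>\<^sub>3 = 0" if "q \<in> G" for q
    using vort that by (auto simp: vorticity_def)
  have "partial_in G e (d_y G w) q - partial_in G e (d_z G v) q - 0 = 0"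
    by (rule deriv_along_zero[where e = e, OF _ \<open>open G\<close> \<open>q \<in> G\<close> V(1)];
        (assumption | intro deriv_along_intros assms))
  moreover have "partial_in G e (d_x G w) q - partial_in G e (d_z G u) q + 0 = 0"
    by (rule deriv_along_zero[where e = e, OF _ \<open>open G\<close> \<open>q \<in> G\<close> V(2)];
        (assumption | intro deriv_along_intros assms))
  moreover have "partial_in G e (d_x G v) q - partial_in G e (d_y G u) q - 0 = 0"
    by (rule deriv_along_zero[where e = e, OF _ \<open>open G\<close> \<open>q \<in> G\<close> V(3)];
        (assumption | intro deriv_along_intros assms))
  ultimately show "partial_in G e (d_y G w) q = partial_in G e (d_z G v) q"
    "partial_in G e (d_x G w) q = partial_in G e (d_z G u) q"
    "partial_in G e (d_x G v) q = partial_in G e (d_y G u) q"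
    by simp_all
qed

text \<open>The Coriolis force is the cross product of (0, 2\<omega>, \<beta>y) with the velocity,
  so \<Omega> + (0, 2\<omega>, \<beta>y) is the absolute vorticity. Its material derivative equals
  its stretching by the velocity gradient; for constant \<Omega> that derivative is (0, 0,
  \<beta>v).\<close>

lemma constant_vorticity_equations:
  assumes "open G" and sm: "smooth_in G u" "smooth_in G v" "smooth_in G w" "smooth_in G P"
    and euler: "euler_equations g \<rho> G u v w P"
    and vort: "\<forall>q\<in>G. vorticity G u v w q = (\<Omega>\<^sub>1, \<Omega>\<^sub>2, \<Omega>\<^sub>3)"
    and "q \<in> G"
  defines "y \<equiv> fst (snd q)"
  shows "\<Omega>\<^sub>1 * d_x G u q + (\<Omega>\<^sub>2 + 2 * earth_rotation) * d_y G u q + (\<Omega>\<^sub>3 + beta_param * y) * d_z G u q = 0"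
    and "\<Omega>\<^sub>1 * d_x G v q + (\<Omega>\<^sub>2 + 2 * earth_rotation) * d_y G v q + (\<Omega>\<^sub>3 + beta_param * y) * d_z G v q = 0"
    and "\<Omega>\<^sub>1 * d_x G w q + (\<Omega>\<^sub>2 + 2 * earth_rotation) * d_y G w q + (\<Omega>\<^sub>3 + beta_param * y) * d_z G w q
      = beta_param * v q"
proof -
  let ?D = "partial_in G" and ?y = "\<lambda>q :: spacetime. fst (snd q)"
    and ?X = "(1, 0, 0, 0) :: spacetime" and ?Y = "(0, 1, 0, 0) :: spacetime"
    and ?Z = "(0, 0, 1, 0) :: spacetime"
  have E1: "d_t G u q + u q * d_x G u q + v q * d_y G u q + w q * d_z G u q
      + (2 * earth_rotation * w q - beta_param * ?y q * v q) + d_x G P q / \<rho> = 0"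
    and E2: "d_t G v q + u q * d_x G v q + v q * d_y G v q + w q * d_z G v q
      + (beta_param * ?y q * u q + earth_rotation\<^sup>2 * ?y q) + d_y G P q / \<rho> = 0"
    and E3: "d_t G w q + u q * d_x G w q + v q * d_y G w q + w q * d_z G w q
      + (g - 2 * earth_rotation * u q - earth_rotation\<^sup>2 * earth_radius) + d_z G P q / \<rho> = 0"
    and div: "d_x G u q + d_y G v q + d_z G w q = 0"
    if "q \<in> G" for q
    using euler[unfolded euler_equations_def Let_def, rule_format, of "fst q" "fst (snd q)"
        "fst (snd (snd q))" "snd (snd (snd q))", unfolded prod.collapse, OF that]
    by - (elim conjE, linarith)+
  have "deriv_along e (\<lambda>q. 2 * earth_rotation * w q - beta_param * ?y q * v q) q
      (2 * earth_rotation * ?D e w q - (beta_param * fst (snd e) * v q + beta_param * ?y q * ?D e v q))"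
    for e
    by (intro deriv_along_intros assms)
  note F1 = momentum_equation_derivative[OF \<open>open G\<close> sm sm(1) E1 \<open>q \<in> G\<close> this, folded y_def]
  have "deriv_along e (\<lambda>q. beta_param * ?y q * u q + earth_rotation\<^sup>2 * ?y q) q
      ((beta_param * fst (snd e) * u q + beta_param * ?y q * ?D e u q) + earth_rotation\<^sup>2 * fst (snd e))"
    for e
    by (intro deriv_along_intros assms)
  note F2 = momentum_equation_derivative[OF \<open>open G\<close> sm sm(2) E2 \<open>q \<in> G\<close> this, folded y_def]
  have "deriv_along e (\<lambda>q. g - 2 * earth_rotation * u q - earth_rotation\<^sup>2 * earth_radius) q
      (0 - 2 * earth_rotation * ?D e u q - 0)"
    for e
    by (intro deriv_along_intros assms)
  note F3 = momentum_equation_derivative[OF \<open>open G\<close> sm sm(3) E3 \<open>q \<in> G\<close> this, folded y_def]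
  have V: "d_y G w q = d_z G v q + \<Omega>\<^sub>1" "d_x G w q = d_z G u q - \<Omega>\<^sub>2" "d_x G v q = d_y G u q + \<Omega>\<^sub>3"
    if "q \<in> G" for q
    using vort that by (auto simp: vorticity_def)
  note DV = constant_vorticity_second_derivatives[OF assms(1-4) vort \<open>q \<in> G\<close>]
  note div = div[OF \<open>q \<in> G\<close>] and V = V[OF \<open>q \<in> G\<close>]
  note comm = partial_in_commute[OF sm(4) \<open>open G\<close> \<open>q \<in> G\<close>]
  note red = fst_conv snd_conv mult_zero_left mult_zero_right mult_1_right add_0_left add_0_right
    diff_0_right diff_0
  \<comment> \<open>Each component of the curl is a difference of two differentiated momentum
    equations, in which the mixed pressure derivatives cancel. The centrifugal term
    \<open>earth_rotation\<^sup>2 * y\<close> drops out because the second equation is never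
    differentiated along y.\<close>
  show "\<Omega>\<^sub>1 * d_x G u q + (\<Omega>\<^sub>2 + 2 * earth_rotation) * d_y G u q + (\<Omega>\<^sub>3 + beta_param * y) * d_z G u q = 0"
    using F3[of ?Y] F2[of ?Z] div unfolding DV V red comm[of ?Y ?Z] by algebra
  show "\<Omega>\<^sub>1 * d_x G v q + (\<Omega>\<^sub>2 + 2 * earth_rotation) * d_y G v q + (\<Omega>\<^sub>3 + beta_param * y) * d_z G v q = 0"
    using F3[of ?X] F1[of ?Z] div unfolding DV V red comm[of ?X ?Z] by algebra
  show "\<Omega>\<^sub>1 * d_x G w q + (\<Omega>\<^sub>2 + 2 * earth_rotation) * d_y G w q + (\<Omega>\<^sub>3 + beta_param * y) * d_z G w q
      = beta_param * v q"
    using F2[of ?X] F1[of ?Y] div unfolding DV V red comm[of ?X ?Y] by algebra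
qed

section \<open>Layers and their time slices\<close>

text \<open>Each coefficient is tested at a point where its monomial has absolute value 2M + 1, more
  than twice the bound.\<close>

lemma bounded_profile:
  fixes a c k M :: real
  assumes "\<And>x y. \<bar>a * x + c * y + k * y\<^sup>2 / 2 + d\<bar> \<le> M"
  shows "a = 0" and "c = 0" and "k = 0"
proof -
  have M: "M \<ge> 0"
    using assms[of 0 0] by linarith
  have bd: "\<bar>d\<bar> \<le> M"
    using assms[of 0 0] by simp
  show "a = 0"
  proof (rule ccontr)
    assume "a \<noteq> 0"
    then show False
      using assms[of "(2 * M + 1) / a" 0] bd M by simp
  qed
  have c: "c = 0"
  proof (rule ccontr)
    assume "c \<noteq> 0"
    \<comment> \<open>At y and -y the quadratic terms coincide, so the difference of the two values
      isolates the linear term.\<close>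
    let ?y = "(2 * M + 1) / c"
    have "\<bar>(2 * M + 1) + k * ?y\<^sup>2 / 2 + d\<bar> \<le> M" "\<bar>k * ?y\<^sup>2 / 2 - (2 * M + 1) + d\<bar> \<le> M"
      using assms[of 0 ?y] assms[of 0 "- ?y"] \<open>c \<noteq> 0\<close> by (simp_all add: power2_eq_square)
    then show False
      using M by linarith
  qed
  then show "c = 0" .
  show "k = 0"
  proof (rule ccontr)
    assume "k \<noteq> 0"
    define y where "y = sqrt ((4 * M + 2) / \<bar>k\<bar>)"
    have "y\<^sup>2 = (4 * M + 2) / \<bar>k\<bar>"
      using M by (simp add: y_def)
    then have "\<bar>k\<bar> * y\<^sup>2 = 4 * M + 2"
      using \<open>k \<noteq> 0\<close> by simp
    then have "\<bar>k * y\<^sup>2\<bar> = 4 * M + 2"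
      by (simp add: abs_mult)
    then show False
      using assms[of 0 y] bd c M by simp
  qed
qed

text \<open>The common setting of both layers. Continuity of the bounding surfaces is enough for the
  layer to have an open interior part with connected time slices.\<close>

locale fluid_layer =
  fixes lo hi :: "real \<times> real \<times> real \<Rightarrow> real"
  assumes continuous_lo: "continuous_on UNIV lo" and continuous_hi: "continuous_on UNIV hi"
    and lo_less_hi: "lo p < hi p"
begin

text \<open>All differential identities are used in the open layer only, where the derivative within the
  layer is the ordinary one. They reach the bounding surfaces by continuity along vertical lines,
  so that uniqueness of derivatives on the boundary plays no role.\<close>
definition open_layer :: "spacetime set" where
  "open_layer = {(x, y, z, t). lo (x, y, t) < z \<and> z < hi (x, y, t)}"

lemma mem_open_layer: "(x, y, z, t) \<in> open_layer \<longleftrightarrow> lo (x, y, t) < z \<and> z < hi (x, y, t)"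
  by (simp add: open_layer_def)

lemma mem_layer: "(x, y, z, t) \<in> layer lo hi \<longleftrightarrow> lo (x, y, t) \<le> z \<and> z \<le> hi (x, y, t)"
  by (simp add: layer_def)

lemma open_layer_subset: "open_layer \<subseteq> layer lo hi"
  by (auto simp: open_layer_def layer_def)

lemma continuous_on_lo_compose: "continuous_on S f \<Longrightarrow> continuous_on S (\<lambda>x. lo (f x))"
  using continuous_on_compose2[OF continuous_lo, of S f] by simp

lemma continuous_on_hi_compose: "continuous_on S f \<Longrightarrow> continuous_on S (\<lambda>x. hi (f x))"
  using continuous_on_compose2[OF continuous_hi, of S f] by simp

lemma open_open_layer: "open open_layer"
proof -
  have "open_layer = {q. lo (fst q, fst (snd q), snd (snd (snd q))) < fst (snd (snd q)) \<and>
      fst (snd (snd q)) < hi (fst q, fst (snd q), snd (snd (snd q)))}"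
    by (auto simp: open_layer_def)
  then show ?thesis
    by (simp only:) (intro open_Collect_conj open_Collect_less continuous_on_lo_compose
        continuous_on_hi_compose continuous_intros)
qed

lemma open_layer_point: "\<exists>z. (x, y, z, t) \<in> open_layer"
  using dense[OF lo_less_hi[of "(x, y, t)"]] by (auto simp: mem_open_layer)

text \<open>After e * z is subtracted, f is constant on an open vertical segment, hence on its
  closure; the strict order of the surfaces makes that closure the full column.\<close>

lemma affine_on_column_closure:
  assumes "continuous_on (layer lo hi) f"
    and "\<And>z. (x, y, z, t) \<in> open_layer \<Longrightarrow> f (x, y, z, t) = d + e * z"
    and "(x, y, z, t) \<in> layer lo hi"
  shows "f (x, y, z, t) = d + e * z"
proof -
  let ?I = "{lo (x, y, t)<..<hi (x, y, t)}"
  have cl: "closure ?I = {lo (x, y, t)..hi (x, y, t)}"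
    using lo_less_hi by (rule closure_greaterThanLessThan)
  have "continuous_on (closure ?I) (\<lambda>z. f (x, y, z, t))"
    unfolding cl
    by (rule continuous_on_compose2[OF assms(1)]) (auto intro!: continuous_intros simp: mem_layer)
  then have "continuous_on (closure ?I) (\<lambda>z. f (x, y, z, t) - e * z)"
    by (intro continuous_intros)
  from continuous_constant_on_closure[OF this, of d z] show ?thesis
    using assms(2,3) by (auto simp: cl mem_open_layer mem_layer)
qed

text \<open>Interpolating linearly between the two surfaces maps the product of the plane with the
  unit interval continuously onto the slice.\<close>

lemma connected_slice: "connected {(x, y, z). (x, y, z, t) \<in> open_layer}"
proof -
  let ?F = "\<lambda>(x, y, s). (x, y, lo (x, y, t) + s * (hi (x, y, t) - lo (x, y, t)))"
  have "connected (?F ` (UNIV \<times> UNIV \<times> {0<..<1 :: real}))"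
    by (intro connected_continuous_image connected_Times)
       (auto simp: case_prod_unfold intro!: continuous_intros continuous_on_lo_compose continuous_on_hi_compose)
  moreover have "?F ` (UNIV \<times> UNIV \<times> {0<..<1}) = {(x, y, z). (x, y, z, t) \<in> open_layer}"
  proof (intro equalityI subsetI)
    fix p assume "p \<in> ?F ` (UNIV \<times> UNIV \<times> {0<..<1})"
    then obtain r where r: "p = ?F r" "r \<in> UNIV \<times> UNIV \<times> {0<..<1}"
      by (rule imageE)
    obtain x y s where "r = (x, y, s)"
      by (rule prod_cases3)
    then have p: "p = ?F (x, y, s)" and s: "0 < s" "s < 1"
      using r by auto
    have "s * (hi (x, y, t) - lo (x, y, t)) < 1 * (hi (x, y, t) - lo (x, y, t))"
      using s lo_less_hi by (intro mult_strict_right_mono) auto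
    then have "lo (x, y, t) + s * (hi (x, y, t) - lo (x, y, t)) < hi (x, y, t)"
      by (simp add: algebra_simps)
    then show "p \<in> {(x, y, z). (x, y, z, t) \<in> open_layer}"
      using p s lo_less_hi by (auto simp: mem_open_layer)
  next
    fix p assume "p \<in> {(x, y, z). (x, y, z, t) \<in> open_layer}"
    then obtain x y z where p: "p = (x, y, z)" and z: "lo (x, y, t) < z" "z < hi (x, y, t)"
      by (auto simp: mem_open_layer)
    define s where "s = (z - lo (x, y, t)) / (hi (x, y, t) - lo (x, y, t))"
    have "p = ?F (x, y, s)" "0 < s" "s < 1"
      using p z lo_less_hi[of "(x, y, t)"] by (auto simp: s_def)
    then show "p \<in> ?F ` (UNIV \<times> UNIV \<times> {0<..<1})"
      by (intro image_eqI[of _ _ "(x, y, s)"]) simp_all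
  qed
  ultimately show ?thesis
    by simp
qed

lemma open_slice: "open {(x, y, z). (x, y, z, t) \<in> open_layer}"
proof -
  have "{(x, y, z). (x, y, z, t) \<in> open_layer}
      = (\<lambda>p. (fst p, fst (snd p), snd (snd p), t)) -` open_layer"
    by auto
  then show ?thesis
    by (simp only:) (intro open_vimage open_open_layer continuous_intros)
qed

text \<open>On a connected open slice a function is determined by its gradient up to a constant. The
  slope k in the y-component is there for the pressure, whose gradient inherits the factor y of the
  Coriolis and centrifugal terms.\<close>

lemma slice_profile_open:
  assumes "f differentiable_on open_layer"
    and D: "\<And>x y z. (x, y, z, t) \<in> open_layer \<Longrightarrow> d_x open_layer f (x, y, z, t) = a \<and>
      d_y open_layer f (x, y, z, t) = c + k * y \<and> d_z open_layer f (x, y, z, t) = e"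
  obtains d where
    "\<And>x y z. (x, y, z, t) \<in> open_layer \<Longrightarrow> f (x, y, z, t) = a * x + c * y + k * y\<^sup>2 / 2 + d + e * z"
proof -
  let ?s = "{(x, y, z). (x, y, z, t) \<in> open_layer}"
  define F where "F p = f (fst p, fst (snd p), snd (snd p), t)
    - (a * fst p + c * fst (snd p) + k * (fst (snd p))\<^sup>2 / 2 + e * snd (snd p))" for p
  have dF: "(F has_derivative (\<lambda>p. 0)) (at p)" if "p \<in> ?s" for p
  proof -
    obtain x y z where p: "p = (x, y, z)"
      by (cases p) auto
    let ?q = "(x, y, z, t)"
    have q: "?q \<in> open_layer"
      using that p by simp
    have f: "(f has_derivative (\<lambda>e. partial_in open_layer e f ?q)) (at ?q)"
      using differentiable_on_has_derivative_partial[OF assms(1) open_open_layer q] .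
    have l: "linear (\<lambda>e. partial_in open_layer e f ?q)"
      by (rule has_derivative_linear[OF f])
    have lin: "partial_in open_layer (h\<^sub>1, h\<^sub>2, h\<^sub>3, 0) f ?q = h\<^sub>1 * a + h\<^sub>2 * (c + k * y) + h\<^sub>3 * e" for h\<^sub>1 h\<^sub>2 h\<^sub>3
    proof -
      have "(h\<^sub>1, h\<^sub>2, h\<^sub>3, 0 :: real)
          = h\<^sub>1 *\<^sub>R (1, 0, 0, 0) + h\<^sub>2 *\<^sub>R (0, 1, 0, 0) + h\<^sub>3 *\<^sub>R (0, 0, 1, 0)"
        by simp
      then show ?thesis
        using D[OF q] by (simp only: linear_add[OF l] linear_scale[OF l] real_scaleR_def)
    qed
    have g: "((\<lambda>p :: real \<times> real \<times> real. (fst p, fst (snd p), snd (snd p), t))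
        has_derivative (\<lambda>h. (fst h, fst (snd h), snd (snd h), 0))) (at p)"
      by (auto intro!: derivative_eq_intros)
    have "((\<lambda>p. f (fst p, fst (snd p), snd (snd p), t)) has_derivative
        (\<lambda>h. fst h * a + fst (snd h) * (c + k * y) + snd (snd h) * e)) (at p)"
      using diff_chain_at[OF g, of f "\<lambda>e. partial_in open_layer e f ?q"] f p by (simp add: o_def lin)
    then show ?thesis
      unfolding F_def
      by (rule has_derivative_eq_rhs[OF has_derivative_diff])
         (auto intro!: derivative_eq_intros simp: p field_simps)
  qed
  obtain z\<^sub>0 where z\<^sub>0: "(0, 0, z\<^sub>0) \<in> ?s"
    using open_layer_point[of 0 0 t] by auto
  define d where "d = F (0, 0, z\<^sub>0)"
  have "F p = d" if "p \<in> ?s" for p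
    unfolding d_def
    by (rule has_derivative_zero_unique_connected[OF open_slice connected_slice dF that z\<^sub>0])
  then have "f (x, y, z, t) = (a * x + c * y + k * y\<^sup>2 / 2 + d) + e * z" if "(x, y, z, t) \<in> open_layer" for x y z
    using that by (auto simp: F_def algebra_simps)
  then show thesis
    using that by blast
qed

lemma slice_profile:
  assumes "smooth_in (layer lo hi) f"
    and "\<And>x y z. (x, y, z, t) \<in> open_layer \<Longrightarrow> d_x open_layer f (x, y, z, t) = a \<and>
      d_y open_layer f (x, y, z, t) = c + k * y \<and> d_z open_layer f (x, y, z, t) = e"
  obtains d where
    "\<And>x y z. (x, y, z, t) \<in> layer lo hi \<Longrightarrow> f (x, y, z, t) = a * x + c * y + k * y\<^sup>2 / 2 + d + e * z"
proof -
  have "f differentiable_on open_layer"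
    using assms(1) open_layer_subset differentiable_on_subset smooth_in_differentiable_on by blast
  from slice_profile_open[OF this assms(2)] obtain d where
    "\<And>x y z. (x, y, z, t) \<in> open_layer \<Longrightarrow> f (x, y, z, t) = a * x + c * y + k * y\<^sup>2 / 2 + d + e * z"
    by blast
  then show thesis
    using that affine_on_column_closure[OF smooth_in_continuous_on[OF assms(1)]] by blast
qed

text \<open>The profile is evaluated on the lower surface. The bound on \<open>e * lo\<close> is
  trivial when e = 0, which serves the velocities, and comes from a bounded surface in the case of
  the pressure.\<close>

lemma bounded_slice_profile:
  assumes "smooth_in (layer lo hi) f" and "bounded_in_space (layer lo hi) f"
    and "\<And>x y z. (x, y, z, t) \<in> open_layer \<Longrightarrow> d_x open_layer f (x, y, z, t) = a \<and>
      d_y open_layer f (x, y, z, t) = c + k * y \<and> d_z open_layer f (x, y, z, t) = e"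
    and "\<And>x y. \<bar>e * lo (x, y, t)\<bar> \<le> N"
  shows "a = 0" and "c = 0" and "k = 0"
proof -
  obtain d where
    d: "\<And>x y z. (x, y, z, t) \<in> layer lo hi \<Longrightarrow> f (x, y, z, t) = a * x + c * y + k * y\<^sup>2 / 2 + d + e * z"
    using slice_profile[OF assms(1,3)] by blast
  obtain M where M: "\<And>x y z. (x, y, z, t) \<in> layer lo hi \<Longrightarrow> \<bar>f (x, y, z, t)\<bar> \<le> M"
    using assms(2) unfolding bounded_in_space_def bounded_iff real_norm_def by blast
  have "\<bar>a * x + c * y + k * y\<^sup>2 / 2 + d\<bar> \<le> M + N" for x y
  proof -
    have "(x, y, lo (x, y, t), t) \<in> layer lo hi"
      using lo_less_hi by (simp add: mem_layer less_imp_le)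
    from M[OF this] d[OF this] assms(4)[of x y] show ?thesis
      by linarith
  qed
  from bounded_profile[OF this] show "a = 0" "c = 0" "k = 0"
    by blast+
qed

section \<open>Functions that depend on time only\<close>

lemma smooth_in_open_layer: "smooth_in (layer lo hi) f \<Longrightarrow> smooth_in open_layer f"
  using smooth_in_open_subset[OF _ open_open_layer open_layer_subset] .

lemma partial_in_open_layer:
  "q \<in> open_layer \<Longrightarrow> partial_in (layer lo hi) e f q = partial_in open_layer e f q"
  using partial_in_open_subset[OF open_open_layer open_layer_subset] .

lemma euler_equations_open_layer:
  assumes "euler_equations g \<rho> (layer lo hi) u v w P"
  shows "euler_equations g \<rho> open_layer u v w P"
  using assms unfolding euler_equations_def Let_def
  by (simp add: partial_in_open_layer[symmetric] subsetD[OF open_layer_subset])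

definition spatially_flat :: "(spacetime \<Rightarrow> real) \<Rightarrow> bool" where
  "spatially_flat f \<longleftrightarrow>
    (\<forall>q\<in>open_layer. d_x open_layer f q = 0 \<and> d_y open_layer f q = 0 \<and> d_z open_layer f q = 0)"

lemma spatially_flat_slice_constant:
  assumes "smooth_in open_layer f" and "spatially_flat f"
  obtains d where "\<And>x y z. (x, y, z, t) \<in> open_layer \<Longrightarrow> f (x, y, z, t) = d"
proof -
  have "\<And>x y z. (x, y, z, t) \<in> open_layer \<Longrightarrow> d_x open_layer f (x, y, z, t) = 0 \<and>
      d_y open_layer f (x, y, z, t) = 0 + 0 * y \<and> d_z open_layer f (x, y, z, t) = 0"
    using assms(2) by (simp add: spatially_flat_def)
  from slice_profile_open[OF smooth_in_differentiable_on[OF assms(1)] this] that show thesis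
    by auto
qed

lemma spatially_flat_time_dependent:
  assumes "smooth_in (layer lo hi) f" and "spatially_flat f"
  obtains F where "\<And>x y z t. (x, y, z, t) \<in> layer lo hi \<Longrightarrow> f (x, y, z, t) = F t"
proof -
  have "\<exists>d. \<forall>x y z. (x, y, z, t) \<in> layer lo hi \<longrightarrow> f (x, y, z, t) = d" for t
  proof -
    have "\<And>x y z. (x, y, z, t) \<in> open_layer \<Longrightarrow> d_x open_layer f (x, y, z, t) = 0 \<and>
        d_y open_layer f (x, y, z, t) = 0 + 0 * y \<and> d_z open_layer f (x, y, z, t) = 0"
      using assms(2) by (simp add: spatially_flat_def)
    from slice_profile[OF assms(1) this] obtain d where
      "\<And>x y z. (x, y, z, t) \<in> layer lo hi \<Longrightarrow> f (x, y, z, t) = 0 * x + 0 * y + 0 * y\<^sup>2 / 2 + d + 0 * z"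
      by blast
    then have "\<forall>x y z. (x, y, z, t) \<in> layer lo hi \<longrightarrow> f (x, y, z, t) = d"
      by simp
    then show ?thesis ..
  qed
  then show thesis
    using that by metis
qed

text \<open>Makes accelerations constant on each time slice by commuting derivatives, without
  differentiating a representing function of time.\<close>

lemma spatially_flat_d_t:
  assumes "smooth_in open_layer f" and "spatially_flat f"
  shows "spatially_flat (d_t open_layer f)"
  unfolding spatially_flat_def
proof (intro ballI conjI)
  fix q assume q: "q \<in> open_layer"
  have "partial_in open_layer e (d_t open_layer f) q = 0"
    if "\<And>q. q \<in> open_layer \<Longrightarrow> partial_in open_layer e f q = 0" for e
    using partial_in_commute[OF assms(1) open_open_layer q, of e]
      partial_in_eq_zero[OF smooth_in_partial[OF assms(1), of e] open_open_layer q that] by simp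
  then show "d_x open_layer (d_t open_layer f) q = 0" "d_y open_layer (d_t open_layer f) q = 0"
    "d_z open_layer (d_t open_layer f) q = 0"
    using assms(2) by (auto simp: spatially_flat_def)
qed

lemma time_dependent_partial_zero:
  assumes "smooth_in (layer lo hi) f"
    and F: "\<And>x y z t. (x, y, z, t) \<in> layer lo hi \<Longrightarrow> f (x, y, z, t) = F t"
    and e: "snd (snd (snd e)) = 0" and "q \<in> layer lo hi"
  shows "partial_in (layer lo hi) e f q = 0"
proof -
  have eq: "f q - F (snd (snd (snd q))) = 0" if "q \<in> open_layer" for q
    using that F open_layer_subset by (cases q) auto
  \<comment> \<open>The direction e has no time component, so F is constant along the line; no
    regularity of F is required.\<close>
  have "deriv_along e (\<lambda>q. F (snd (snd (snd q)))) q 0" for q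
    using e by (simp add: deriv_along_def)
  then have "partial_in open_layer e f q - 0 = 0" if "q \<in> open_layer" for q
    using deriv_along_zero[OF deriv_along_diff[OF
        deriv_along_smooth[OF smooth_in_open_layer[OF assms(1)] open_open_layer that]]
        open_open_layer that eq] by blast
  \<comment> \<open>The dummy \<open>0 * z\<close> gives the affine shape needed to pass to the
    boundary of the column.\<close>
  then have zero: "partial_in (layer lo hi) e f q = 0 + 0 * z" if "q \<in> open_layer" for q and z :: real
    using that by (simp add: partial_in_open_layer)
  obtain x y z t where q: "q = (x, y, z, t)"
    by (cases q) auto
  have "partial_in (layer lo hi) e f (x, y, z, t) = 0 + 0 * z"
    using smooth_in_continuous_on[OF smooth_in_partial[OF assms(1)]] zero assms(4)[unfolded q]
    by (rule affine_on_column_closure)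
  then show ?thesis
    by (simp add: q)
qed

lemma time_dependent_spatially_flat:
  assumes "smooth_in (layer lo hi) f"
    and "\<And>x y z t. (x, y, z, t) \<in> layer lo hi \<Longrightarrow> f (x, y, z, t) = F t"
  shows "spatially_flat f"
  unfolding spatially_flat_def
  using time_dependent_partial_zero[OF assms] open_layer_subset
  by (metis (no_types, lifting) partial_in_open_layer snd_conv subsetD)

lemma time_dependent_constant_vorticity:
  assumes "smooth_in (layer lo hi) u" "smooth_in (layer lo hi) v" "smooth_in (layer lo hi) w"
    and "\<And>x y z t. (x, y, z, t) \<in> layer lo hi \<Longrightarrow>
      u (x, y, z, t) = U t \<and> v (x, y, z, t) = 0 \<and> w (x, y, z, t) = W t"
  shows "constant_vorticity (layer lo hi) u v w"
proof -
  have "vorticity (layer lo hi) u v w q = (0, 0, 0)" if "q \<in> layer lo hi" for q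
    using time_dependent_partial_zero[of u U _ q] time_dependent_partial_zero[of v "\<lambda>_. 0" _ q]
      time_dependent_partial_zero[of w W _ q] assms that
    by (simp add: vorticity_def)
  then show ?thesis
    unfolding constant_vorticity_def by blast
qed

end

section \<open>Constant vorticity\<close>

lemma earth_rotation_pos: "earth_rotation > 0"
  and earth_radius_pos: "earth_radius > 0"
  and beta_param_pos: "beta_param > 0"
  by (simp_all add: earth_rotation_def earth_radius_def beta_param_def)

lemma euler_equations_divergence:
  assumes "euler_equations g \<rho> G u v w P" and "q \<in> G"
  shows "d_x G u q + d_y G v q + d_z G w q = 0"
  using assms unfolding euler_equations_def Let_def by (cases q) blast

lemma euler_equations_divergence_derivative:
  assumes "open G" and sm: "smooth_in G u" "smooth_in G v" "smooth_in G w"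
    and euler: "euler_equations g \<rho> G u v w P" and "q \<in> G"
  shows "partial_in G e (d_x G u) q + partial_in G e (d_y G v) q + partial_in G e (d_z G w) q = 0"
  by (rule deriv_along_zero[where e = e, OF _ \<open>open G\<close> \<open>q \<in> G\<close> euler_equations_divergence[OF euler]];
      (assumption | intro deriv_along_intros assms))

text \<open>The Laplacian of a velocity field is the gradient of its divergence minus the curl of
  its curl; here the divergence is zero and the curl is constant.\<close>

lemma constant_vorticity_harmonic:
  assumes "open G" and sm: "smooth_in G u" "smooth_in G v" "smooth_in G w"
    and "euler_equations g \<rho> G u v w P"
    and "\<forall>q\<in>G. vorticity G u v w q = (\<Omega>\<^sub>1, \<Omega>\<^sub>2, \<Omega>\<^sub>3)"
  shows "harmonic G u" and "harmonic G v" and "harmonic G w"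
proof -
  let ?X = "(1, 0, 0, 0) :: spacetime" and ?Y = "(0, 1, 0, 0) :: spacetime"
    and ?Z = "(0, 0, 1, 0) :: spacetime"
  note rot = constant_vorticity_second_derivatives[OF assms(1-4,6)]
    and div = euler_equations_divergence_derivative[OF assms(1-5)]
    and comm = partial_in_commute[OF _ assms(1)]
  show "harmonic G u" unfolding harmonic_def
    using rot(2)[of _ ?Z] rot(3)[of _ ?Y] div[of _ ?X]
      comm[OF sm(2), of _ ?X ?Y] comm[OF sm(3), of _ ?X ?Z] by auto
  show "harmonic G v" unfolding harmonic_def
    using rot(1)[of _ ?Z] rot(3)[of _ ?X] div[of _ ?Y]
      comm[OF sm(1), of _ ?X ?Y] comm[OF sm(3), of _ ?Y ?Z] by fastforce
  show "harmonic G w" unfolding harmonic_def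
    using rot(1)[of _ ?Y] rot(2)[of _ ?X] div[of _ ?Z]
      comm[OF sm(1), of _ ?X ?Z] comm[OF sm(2), of _ ?Y ?Z] by fastforce
qed

text \<open>The z-derivative of the transport equation has lost the mixed derivative, so that its own
  y-derivative isolates the second z-derivative.\<close>
lemma transport_second_z_derivative_zero:
  assumes "open G" and sm: "smooth_in G f" "smooth_in G h" and "\<beta> \<noteq> 0"
    and eq: "\<And>q. q \<in> G \<Longrightarrow>
      a * d_x G f q + b * d_y G f q + (c + \<beta> * fst (snd q)) * d_z G f q - k * h q = 0"
    and yz: "\<And>q. q \<in> G \<Longrightarrow> d_y G (d_z G f) q = 0" "\<And>q. q \<in> G \<Longrightarrow> d_y G (d_z G h) q = 0"
    and "q \<in> G"
  shows "d_z G (d_z G f) q = 0"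
proof -
  let ?D = "partial_in G" and ?Y = "(0, 1, 0, 0) :: spacetime" and ?Z = "(0, 0, 1, 0) :: spacetime"
  have dz: "a * ?D ?Z (d_x G f) q + b * ?D ?Z (d_y G f) q
      + ((0 + \<beta> * fst (snd ?Z)) * d_z G f q + (c + \<beta> * fst (snd q)) * ?D ?Z (d_z G f) q)
      - k * ?D ?Z h q = 0"
    if "q \<in> G" for q
    by (rule deriv_along_zero[where e = ?Z, OF _ \<open>open G\<close> that eq];
        (assumption | intro deriv_along_intros assms that))
  have eq': "a * d_z G (d_x G f) q + (c + \<beta> * fst (snd q)) * d_z G (d_z G f) q - k * d_z G h q = 0"
    if "q \<in> G" for q
    using dz[OF that] yz(1)[OF that] partial_in_commute[OF sm(1) \<open>open G\<close> that, of ?Y ?Z] by simp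
  have "a * ?D ?Y (d_z G (d_x G f)) q
      + ((0 + \<beta> * fst (snd ?Y)) * d_z G (d_z G f) q + (c + \<beta> * fst (snd q)) * ?D ?Y (d_z G (d_z G f)) q)
      - k * ?D ?Y (d_z G h) q = 0"
    by (rule deriv_along_zero[where e = ?Y, OF _ \<open>open G\<close> \<open>q \<in> G\<close> eq'];
        (assumption | intro deriv_along_intros assms))
  moreover have "?D ?Y (d_z G (d_x G f)) q = 0" "?D ?Y (d_z G (d_z G f)) q = 0"
    using partial_in_commute2[OF sm(1) \<open>open G\<close> \<open>q \<in> G\<close>, of ?Y ?Z]
      partial_in_eq_zero[OF _ \<open>open G\<close> \<open>q \<in> G\<close> yz(1)] sm by (simp_all add: smooth_in_partial)
  ultimately show ?thesis
    using yz(2)[OF \<open>q \<in> G\<close>] \<open>\<beta> \<noteq> 0\<close> by simp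
qed

section \<open>Reduction to velocities that depend on time only\<close>

context fluid_layer
begin

lemma constant_vorticity_spatially_flat:
  assumes sm: "smooth_in (layer lo hi) u" "smooth_in (layer lo hi) v"
      "smooth_in (layer lo hi) w" "smooth_in (layer lo hi) P"
    and eul: "euler_equations g \<rho> (layer lo hi) u v w P"
    and vort: "constant_vorticity (layer lo hi) u v w"
    and bd: "bounded_in_space (layer lo hi) v" "bounded_in_space (layer lo hi) w"
  shows "spatially_flat u" and "spatially_flat w" and "\<And>q. q \<in> open_layer \<Longrightarrow> v q = 0"
proof -
  let ?G = open_layer
  let ?D = "partial_in ?G" and ?y = "\<lambda>q :: spacetime. fst (snd q)"
    and ?X = "(1, 0, 0, 0) :: spacetime" and ?Y = "(0, 1, 0, 0) :: spacetime"
    and ?Z = "(0, 0, 1, 0) :: spacetime"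
  let ?A = "2 * earth_rotation"
  note opn = open_open_layer
  note smG = sm[THEN smooth_in_open_layer]
  note euler = euler_equations_open_layer[OF eul]
  obtain \<Omega>\<^sub>1 \<Omega>\<^sub>2 \<Omega>\<^sub>3 where "\<And>q. q \<in> layer lo hi \<Longrightarrow> vorticity (layer lo hi) u v w q = (\<Omega>\<^sub>1, \<Omega>\<^sub>2, \<Omega>\<^sub>3)"
    using vort unfolding constant_vorticity_def by (metis prod_cases3)
  then have vortG: "\<forall>q\<in>?G. vorticity ?G u v w q = (\<Omega>\<^sub>1, \<Omega>\<^sub>2, \<Omega>\<^sub>3)"
    using open_layer_subset unfolding vorticity_def by (auto simp: partial_in_open_layer[symmetric])
  then have V: "d_y ?G w q - d_z ?G v q = \<Omega>\<^sub>1" "d_z ?G u q - d_x ?G w q = \<Omega>\<^sub>2"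
      "d_x ?G v q - d_y ?G u q = \<Omega>\<^sub>3"
    if "q \<in> ?G" for q
    using that by (auto simp: vorticity_def)
  note E = constant_vorticity_equations[OF opn smG euler vortG]
  note harm = constant_vorticity_harmonic[OF opn smG(1-3) euler vortG]
  note rot = constant_vorticity_second_derivatives[OF opn smG(1-3) vortG]
    and div = euler_equations_divergence_derivative[OF opn smG(1-3) euler]
    and comm = partial_in_commute[OF _ opn]
  \<comment> \<open>The vanishing sources \<open>0 * u q\<close> and \<open>0 * v q\<close> give the
    equations of u and v the same shape as that of w, whose source is
    \<open>beta_param * v q\<close>.\<close>
  have Eu: "\<Omega>\<^sub>1 * d_x ?G u q + (\<Omega>\<^sub>2 + ?A) * d_y ?G u q + (\<Omega>\<^sub>3 + beta_param * ?y q) * d_z ?G u q - 0 * u q = 0"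
    and Ev: "\<Omega>\<^sub>1 * d_x ?G v q + (\<Omega>\<^sub>2 + ?A) * d_y ?G v q + (\<Omega>\<^sub>3 + beta_param * ?y q) * d_z ?G v q - 0 * v q = 0"
    and Ew: "\<Omega>\<^sub>1 * d_x ?G w q + (\<Omega>\<^sub>2 + ?A) * d_y ?G w q + (\<Omega>\<^sub>3 + beta_param * ?y q) * d_z ?G w q
      - beta_param * v q = 0"
    if "q \<in> ?G" for q
    using E[OF that] by simp_all
  have beta: "beta_param \<noteq> 0"
    using beta_param_pos by simp
  have uyz: "d_y ?G (d_z ?G u) q = 0" and vyz: "d_y ?G (d_z ?G v) q = 0" and wyz: "d_y ?G (d_z ?G w) q = 0"
    if "q \<in> ?G" for q
    using harmonic_transport_mixed_zero[OF opn smG(1,1) harm(1,1) beta Eu that]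
      harmonic_transport_mixed_zero[OF opn smG(2,2) harm(2,2) beta Ev that]
      harmonic_transport_mixed_zero[OF opn smG(3,2) harm(3,2) beta Ew that] by auto
  have uzz: "d_z ?G (d_z ?G u) q = 0" and wzz: "d_z ?G (d_z ?G w) q = 0" if "q \<in> ?G" for q
    using transport_second_z_derivative_zero[OF opn smG(1,1) beta Eu uyz uyz that]
      transport_second_z_derivative_zero[OF opn smG(3,2) beta Ew wyz vyz that] by auto
  have wxz: "d_x ?G (d_z ?G w) q = 0" "d_z ?G (d_x ?G w) q = 0"
    and wxy: "d_y ?G (d_x ?G w) q = 0" "d_x ?G (d_y ?G w) q = 0"
    and wzy: "d_z ?G (d_y ?G w) q = 0"
    and wxx: "d_x ?G (d_x ?G w) q = 0" and wyy: "d_y ?G (d_y ?G w) q = 0"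
    if "q \<in> ?G" for q
  proof -
    show "d_z ?G (d_x ?G w) q = 0" "d_y ?G (d_x ?G w) q = 0"
      using rot(2)[OF that] uzz[OF that] uyz[OF that] by simp_all
    then show "d_x ?G (d_z ?G w) q = 0" "d_x ?G (d_y ?G w) q = 0"
      using comm[OF smG(3) that, of ?X] by simp_all
    show "d_z ?G (d_y ?G w) q = 0"
      using comm[OF smG(3) that, of ?Z ?Y] wyz[OF that] by simp
    \<comment> \<open>The z-derivative of incompressibility expresses this through the yz-derivative
      of v and the zz-derivative of w, both already zero.\<close>
    have "d_x ?G (d_z ?G u) q = 0"
      using comm[OF smG(1) that, of ?X ?Z] comm[OF smG(2) that, of ?Z ?Y] div[OF that, of ?Z]
        vyz[OF that] wzz[OF that] by simp
    then show "d_x ?G (d_x ?G w) q = 0"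
      using rot(2)[OF that] by simp
    then show "d_y ?G (d_y ?G w) q = 0"
      using harm(3)[unfolded harmonic_def, rule_format, OF that] wzz[OF that] by linarith
  qed
  have flat: "spatially_flat (d_x ?G w)" "spatially_flat (d_y ?G w)" "spatially_flat (d_z ?G w)"
    unfolding spatially_flat_def using wxz wxy wzy wxx wyy wyz wzz by auto
  have dEw: "\<Omega>\<^sub>1 * ?D e (d_x ?G w) q + (\<Omega>\<^sub>2 + ?A) * ?D e (d_y ?G w) q
      + ((0 + beta_param * fst (snd e)) * d_z ?G w q + (\<Omega>\<^sub>3 + beta_param * ?y q) * ?D e (d_z ?G w) q)
      - beta_param * ?D e v q = 0"
    if "q \<in> ?G" for q e
    by (rule deriv_along_zero[where e = e, OF _ opn that Ew];
        (assumption | intro deriv_along_intros smG opn that))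
  \<comment> \<open>With all second derivatives of w gone, \<open>dEw\<close> retains only the
    derivative of the variable coefficient and that of the source; only e along y yields a
    nontrivial relation.\<close>
  have Dv: "d_x ?G v q = 0" "d_y ?G v q = d_z ?G w q" "d_z ?G v q = 0" if "q \<in> ?G" for q
    using dEw[OF that, of ?X] dEw[OF that, of ?Y] dEw[OF that, of ?Z] flat that beta
    by (auto simp: spatially_flat_def)
  have Dw: "d_x ?G w q = 0" "d_y ?G w q = 0" "d_z ?G w q = 0" if q: "q \<in> ?G" for q
  proof -
    obtain x y z t where qt: "q = (x, y, z, t)"
      by (cases q) auto
    obtain m\<^sub>1 m\<^sub>2 m\<^sub>3 where m: "\<And>x y z. (x, y, z, t) \<in> ?G \<Longrightarrow> d_x ?G w (x, y, z, t) = m\<^sub>1"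
      "\<And>x y z. (x, y, z, t) \<in> ?G \<Longrightarrow> d_y ?G w (x, y, z, t) = m\<^sub>2"
      "\<And>x y z. (x, y, z, t) \<in> ?G \<Longrightarrow> d_z ?G w (x, y, z, t) = m\<^sub>3"
      using flat smG(3) by (metis spatially_flat_slice_constant smooth_in_partial)
    \<comment> \<open>On the slice v has slope \<open>m\<^sub>3\<close> along y and no other slope,
      so its boundedness applies with e = 0. Only afterwards is w free of a z-slope, and its other
      two slopes can be treated although the surface heights may be unbounded.\<close>
    have "m\<^sub>3 = 0"
      using bounded_slice_profile(2)[OF sm(2) bd(1), of t 0 m\<^sub>3 0 0 0] Dv m(3) by simp
    moreover from this have "m\<^sub>1 = 0" "m\<^sub>2 = 0"
      using bounded_slice_profile(1,2)[OF sm(3) bd(2), of t m\<^sub>1 m\<^sub>2 0 0 0] m by simp_all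
    ultimately show "d_x ?G w q = 0" "d_y ?G w q = 0" "d_z ?G w q = 0"
      using m q qt by auto
  qed
  then show "spatially_flat w"
    by (simp add: spatially_flat_def)
  show v0: "v q = 0" if "q \<in> ?G" for q
    using Ew[OF that] Dw[OF that] beta by simp
  have Du: "d_x ?G u q = 0" "d_y ?G u q = - \<Omega>\<^sub>3" "d_z ?G u q = \<Omega>\<^sub>2" if "q \<in> ?G" for q
    using V[OF that] Dw[OF that] Dv[OF that] euler_equations_divergence[OF euler that] by auto
  have lin: "(\<Omega>\<^sub>2 + ?A) * - \<Omega>\<^sub>3 + (\<Omega>\<^sub>3 + beta_param * y) * \<Omega>\<^sub>2 = 0" for y
  proof -
    obtain z where q: "(0, y, z, 0) \<in> ?G"
      using open_layer_point by blast
    show ?thesis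
      using Eu[OF q] Du[OF q] by simp
  qed
  \<comment> \<open>\<open>lin\<close> is affine in y with slope
    \<open>beta_param * \<Omega>\<^sub>2\<close> and constant term
    \<open>- 2 * earth_rotation * \<Omega>\<^sub>3\<close>; it holds for every y because the layer
    extends over the whole plane.\<close>
  have "\<Omega>\<^sub>2 = 0"
    using lin[of 0] lin[of 1] beta earth_rotation_pos by (auto simp: algebra_simps)
  moreover from this have "\<Omega>\<^sub>3 = 0"
    using lin[of 0] earth_rotation_pos by simp
  ultimately show "spatially_flat u"
    using Du by (simp add: spatially_flat_def)
qed

lemma constant_vorticity_velocity:
  assumes sm: "smooth_in (layer lo hi) u" "smooth_in (layer lo hi) v"
      "smooth_in (layer lo hi) w" "smooth_in (layer lo hi) P"
    and "euler_equations g \<rho> (layer lo hi) u v w P"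
    and "constant_vorticity (layer lo hi) u v w"
    and "bounded_in_space (layer lo hi) v" "bounded_in_space (layer lo hi) w"
  obtains U W where "\<And>x y z t. (x, y, z, t) \<in> layer lo hi \<Longrightarrow>
    u (x, y, z, t) = U t \<and> v (x, y, z, t) = 0 \<and> w (x, y, z, t) = W t"
proof -
  note flat = constant_vorticity_spatially_flat[OF assms]
  obtain U where "\<And>x y z t. (x, y, z, t) \<in> layer lo hi \<Longrightarrow> u (x, y, z, t) = U t"
    using spatially_flat_time_dependent[OF sm(1) flat(1)] by blast
  moreover obtain W where "\<And>x y z t. (x, y, z, t) \<in> layer lo hi \<Longrightarrow> w (x, y, z, t) = W t"
    using spatially_flat_time_dependent[OF sm(3) flat(2)] by blast
  moreover have "v (x, y, z, t) = 0" if "(x, y, z, t) \<in> layer lo hi" for x y z t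
    using affine_on_column_closure[OF smooth_in_continuous_on[OF sm(2)], of x y t 0 0 z] flat(3) that
    by simp
  ultimately show thesis
    by (intro that[of U W]) simp
qed

end

section \<open>Bounded pressure\<close>

text \<open>This is \<omega>^2 / \<beta>, the westward speed at which the Coriolis term \<beta>yu
  balances the centrifugal term \<omega>^2 y.\<close>

abbreviation (input) drift_speed :: real where
  "drift_speed \<equiv> earth_rotation * earth_radius / 2"

lemma drift_balance:
  "beta_param * V + earth_rotation\<^sup>2 = 0 \<longleftrightarrow> V = - drift_speed"
proof -
  have "beta_param * V + earth_rotation\<^sup>2 = beta_param * (V + drift_speed)"
    using earth_radius_pos by (simp add: beta_param_def power2_eq_square field_simps)
  then show ?thesis
    using beta_param_pos by auto
qed

lemma euler_equations_pressure_gradient: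
  assumes "euler_equations g \<rho> S u v w P" and "(x, y, z, t) \<in> S" and "\<rho> \<noteq> 0"
  defines "q \<equiv> (x, y, z, t)"
  shows "d_x S P q = - \<rho> * (d_t S u q + u q * d_x S u q + v q * d_y S u q + w q * d_z S u q
      + 2 * earth_rotation * w q - beta_param * y * v q)"
    and "d_y S P q = - \<rho> * (d_t S v q + u q * d_x S v q + v q * d_y S v q + w q * d_z S v q
      + beta_param * y * u q + earth_rotation\<^sup>2 * y)"
    and "d_z S P q = - \<rho> * (d_t S w q + u q * d_x S w q + v q * d_y S w q + w q * d_z S w q
      - 2 * earth_rotation * u q - earth_rotation\<^sup>2 * earth_radius + g)"
  using assms(1)[unfolded euler_equations_def Let_def, rule_format, OF assms(2), folded q_def] \<open>\<rho> \<noteq> 0\<close>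
  by (simp_all add: field_simps)

context fluid_layer
begin

text \<open>The pressure has the term -\<rho>(\<beta>U + \<omega>^2) y^2 / 2, which boundedness
  along the lower surface excludes. The surface bound concerns the single time t, as a bound for the
  interface may vary with time.\<close>

lemma bounded_pressure_drift:
  assumes sm: "smooth_in (layer lo hi) u" "smooth_in (layer lo hi) v"
      "smooth_in (layer lo hi) w" "smooth_in (layer lo hi) P"
    and eul: "euler_equations g \<rho> (layer lo hi) u v w P" and "\<rho> > 0"
    and vel: "\<And>x y z t. (x, y, z, t) \<in> layer lo hi \<Longrightarrow>
      u (x, y, z, t) = U t \<and> v (x, y, z, t) = 0 \<and> w (x, y, z, t) = W t"
    and bd: "bounded_in_space (layer lo hi) P"
    and lo: "\<And>x y. \<bar>lo (x, y, t)\<bar> \<le> M"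
  shows "U t = - drift_speed"
proof -
  let ?G = open_layer
  note smG = sm[THEN smooth_in_open_layer]
  have flat: "spatially_flat u" "spatially_flat v" "spatially_flat w"
    using time_dependent_spatially_flat[OF sm(1), of U] time_dependent_spatially_flat[OF sm(2), of "\<lambda>_. 0"]
      time_dependent_spatially_flat[OF sm(3), of W] vel by blast+
  have "v q = 0" if "q \<in> ?G" for q
    using vel that open_layer_subset by (cases q) auto
  then have dtv: "d_t ?G v q = 0" if "q \<in> ?G" for q
    using partial_in_eq_zero[OF smG(2) open_open_layer that] by blast
  \<comment> \<open>a and c take the place of U'(t) and W'(t), since U and W are not known to be
    differentiable.\<close>
  obtain a where a: "\<And>x y z. (x, y, z, t) \<in> ?G \<Longrightarrow> d_t ?G u (x, y, z, t) = a"
    using spatially_flat_slice_constant[OF smooth_in_partial spatially_flat_d_t] smG(1) flat(1) by metis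
  obtain c where c: "\<And>x y z. (x, y, z, t) \<in> ?G \<Longrightarrow> d_t ?G w (x, y, z, t) = c"
    using spatially_flat_slice_constant[OF smooth_in_partial spatially_flat_d_t] smG(3) flat(3) by metis
  let ?a = "- \<rho> * (a + 2 * earth_rotation * W t)"
  let ?k = "- \<rho> * (beta_param * U t + earth_rotation\<^sup>2)"
  let ?e = "- \<rho> * (c - 2 * earth_rotation * U t - earth_rotation\<^sup>2 * earth_radius + g)"
  have "d_x ?G P (x, y, z, t) = ?a \<and> d_y ?G P (x, y, z, t) = 0 + ?k * y \<and> d_z ?G P (x, y, z, t) = ?e"
    if q: "(x, y, z, t) \<in> ?G" for x y z
  proof -
    have v: "u (x, y, z, t) = U t" "v (x, y, z, t) = 0" "w (x, y, z, t) = W t"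
      using vel q open_layer_subset by auto
    note grad = euler_equations_pressure_gradient[OF euler_equations_open_layer[OF eul] q]
    show ?thesis
      using grad \<open>\<rho> > 0\<close> flat q v dtv[OF q] a[OF q] c[OF q]
      by (simp add: spatially_flat_def algebra_simps)
  qed
  moreover have "\<bar>?e * lo (x, y, t)\<bar> \<le> \<bar>?e\<bar> * M" for x y
    unfolding abs_mult[of ?e] using lo by (intro mult_left_mono) auto
  ultimately have "?k = 0"
    by (rule bounded_slice_profile(3)[OF sm(4) bd])
  then show ?thesis
    using \<open>\<rho> > 0\<close> drift_balance[of "U t"] by simp
qed

text \<open>At this velocity the y-terms balance by \<open>drift_balance\<close>, and in the
  vertical equation -2\<omega>u = \<omega>^2 R cancels the centrifugal term, which leaves gravity
  alone.\<close>

lemma drift_hydrostatic_pressure: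
  assumes sm: "smooth_in (layer lo hi) u" "smooth_in (layer lo hi) v"
      "smooth_in (layer lo hi) w" "smooth_in (layer lo hi) P"
    and eul: "euler_equations g \<rho> (layer lo hi) u v w P" and "\<rho> > 0"
    and vel: "\<And>q. q \<in> layer lo hi \<Longrightarrow> u q = - drift_speed \<and> v q = 0 \<and> w q = 0"
  obtains f where "\<And>x y z t. (x, y, z, t) \<in> layer lo hi \<Longrightarrow> P (x, y, z, t) = f t - \<rho> * g * z"
proof -
  let ?G = open_layer
  note smG = sm[THEN smooth_in_open_layer]
  have zero: "partial_in ?G e u q = 0" "partial_in ?G e v q = 0" "partial_in ?G e w q = 0"
    if "q \<in> ?G" for e q
    using partial_in_eq_zero[OF smG(1) open_open_layer that] partial_in_eq_zero[OF smG(2) open_open_layer that]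
      partial_in_eq_zero[OF smG(3) open_open_layer that] vel open_layer_subset by blast+
  have "d_x ?G P (x, y, z, t) = 0 \<and> d_y ?G P (x, y, z, t) = 0 + 0 * y \<and> d_z ?G P (x, y, z, t) = - \<rho> * g"
    if q: "(x, y, z, t) \<in> ?G" for x y z t
  proof -
    have v: "u (x, y, z, t) = - drift_speed" "v (x, y, z, t) = 0" "w (x, y, z, t) = 0"
      using vel q open_layer_subset by auto
    note grad = euler_equations_pressure_gradient[OF euler_equations_open_layer[OF eul] q]
    have "d_y ?G P (x, y, z, t) = - \<rho> * ((beta_param * - drift_speed + earth_rotation\<^sup>2) * y)"
      using grad(2) \<open>\<rho> > 0\<close> by (simp add: zero[OF q] v algebra_simps)
    moreover have "beta_param * - drift_speed + earth_rotation\<^sup>2 = 0"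
      using drift_balance by blast
    moreover have "d_x ?G P (x, y, z, t) = 0" "d_z ?G P (x, y, z, t) = - \<rho> * g"
      using grad(1,3) \<open>\<rho> > 0\<close> by (simp_all add: zero[OF q] v power2_eq_square)
    ultimately show ?thesis
      by simp
  qed
  from slice_profile[OF sm(4) this]
  have "\<exists>d. \<forall>x y z. (x, y, z, t) \<in> layer lo hi \<longrightarrow>
      P (x, y, z, t) = 0 * x + 0 * y + 0 * y\<^sup>2 / 2 + d + - \<rho> * g * z" for t
    by metis
  then obtain f where "\<forall>x y z. (x, y, z, t) \<in> layer lo hi \<longrightarrow>
      P (x, y, z, t) = 0 * x + 0 * y + 0 * y\<^sup>2 / 2 + f t + - \<rho> * g * z" for t
    by metis
  then show thesis
    by (intro that[of f]) simp
qed

lemma hydrostatic_bounded_upper_surface: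
  assumes "bounded_in_space (layer lo hi) P"
    and P: "\<And>x y z t. (x, y, z, t) \<in> layer lo hi \<Longrightarrow> P (x, y, z, t) = f t - \<rho> * g * z"
    and "\<rho> > 0" "g > 0"
  obtains M where "\<And>x y. \<bar>hi (x, y, t)\<bar> \<le> M"
proof -
  obtain M where M: "\<And>x y z. (x, y, z, t) \<in> layer lo hi \<Longrightarrow> \<bar>P (x, y, z, t)\<bar> \<le> M"
    using assms(1) unfolding bounded_in_space_def bounded_iff real_norm_def by blast
  have "\<bar>hi (x, y, t)\<bar> \<le> (M + \<bar>f t\<bar>) / (\<rho> * g)" for x y
  proof -
    have q: "(x, y, hi (x, y, t), t) \<in> layer lo hi"
      using lo_less_hi by (simp add: mem_layer less_imp_le)
    have "\<rho> * g * \<bar>hi (x, y, t)\<bar> = \<bar>\<rho> * g * hi (x, y, t)\<bar>"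
      using assms(3,4) by (simp add: abs_mult)
    also have "\<dots> \<le> M + \<bar>f t\<bar>"
      using M[OF q] P[OF q] by linarith
    finally show ?thesis
      using assms(3,4) by (simp add: pos_le_divide_eq mult.commute)
  qed
  then show thesis
    by (rule that)
qed

end

text \<open>With v = 0 the bottom condition reduces to w = u b_x, and b_x vanishes.\<close>

lemma bottom_condition_x_independent:
  assumes "bottom_condition b u v w" and "b differentiable_on UNIV" and "\<And>x y. b (x, y) = B y"
    and "v (x, y, b (x, y), t) = 0"
  shows "w (x, y, b (x, y), t) = 0"
proof -
  have "((\<lambda>s. b ((x, y) + s *\<^sub>R (1, 0))) has_real_derivative partial_in UNIV (1, 0) b (x, y)) (at 0)"
    using DERIV_along_line[OF assms(2), of "(x, y)" 0 "(1, 0)"] by simp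
  then have "partial_in UNIV (1, 0) b (x, y) = 0"
    using assms(3) DERIV_unique[OF _ DERIV_const[of "B y" "at 0"]] by simp
  then show ?thesis
    using assms(1,4) by (simp add: bottom_condition_def Let_def)
qed

text \<open>The condition becomes h_t + U h_x = 0 with constant U, so h is constant along the
  characteristic lines of direction (U, 0, 1).\<close>

lemma kinematic_condition_travelling:
  assumes kin: "kinematic_condition h u v w" and h: "h differentiable_on UNIV"
    and vel: "\<And>x y t. u (x, y, h (x, y, t), t) = U \<and> v (x, y, h (x, y, t), t) = 0 \<and> w (x, y, h (x, y, t), t) = 0"
  shows "h (x, y, t) = h (x - U * t, y, 0)"
proof -
  let ?e = "(U, 0, 1) :: real \<times> real \<times> real"
  have zero: "partial_in UNIV ?e h p = 0" for p
  proof -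
    obtain x y t where p: "p = (x, y, t)"
      by (cases p) auto
    have l: "linear (\<lambda>e. partial_in UNIV e h p)"
      using has_derivative_linear[OF differentiable_on_has_derivative_partial[OF h]] by simp
    have "?e = U *\<^sub>R (1, 0, 0) + (0, 0, 1)"
      by simp
    then have "partial_in UNIV ?e h p = U * partial_in UNIV (1, 0, 0) h p + partial_in UNIV (0, 0, 1) h p"
      by (simp only: linear_add[OF l] linear_scale[OF l] real_scaleR_def)
    then show ?thesis
      using kin[unfolded kinematic_condition_def Let_def, rule_format, of x y t] vel[of x y t]
      by (simp add: p add.commute)
  qed
  have "((\<lambda>s. h ((x - U * t, y, 0) + s *\<^sub>R ?e)) has_real_derivative 0) (at s)" for s
    using DERIV_along_line[OF h, of "(x - U * t, y, 0)" s ?e] by (simp only: zero open_UNIV UNIV_I)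
  then have "h ((x - U * t, y, 0) + t *\<^sub>R ?e) = h ((x - U * t, y, 0) + 0 *\<^sub>R ?e)"
    using DERIV_isconst_all[of "\<lambda>s. h ((x - U * t, y, 0) + s *\<^sub>R ?e)" t 0] by blast
  then show ?thesis
    by simp
qed

theorem theorem2p1:
  fixes g \<rho>\<^sub>1 \<rho>\<^sub>2 :: real
    and b p :: "real \<times> real \<Rightarrow> real"
    and u\<^sub>1 v\<^sub>1 w\<^sub>1 P\<^sub>1 u\<^sub>2 v\<^sub>2 w\<^sub>2 P\<^sub>2 :: "real \<times> real \<times> real \<times> real \<Rightarrow> real"
    and \<eta>\<^sub>1 \<eta>\<^sub>2 :: "real \<times> real \<times> real \<Rightarrow> real"
  defines "D\<^sub>1 \<equiv> lower_layer b \<eta>\<^sub>1"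
    and "D\<^sub>2 \<equiv> upper_layer \<eta>\<^sub>1 \<eta>\<^sub>2"
  assumes "g > 0" and "\<rho>\<^sub>1 > 0" and "\<rho>\<^sub>2 > 0"
    and "b differentiable_on UNIV" and "p differentiable_on UNIV"
    and "two_layer_solution g \<rho>\<^sub>1 \<rho>\<^sub>2 b p u\<^sub>1 v\<^sub>1 w\<^sub>1 P\<^sub>1 u\<^sub>2 v\<^sub>2 w\<^sub>2 P\<^sub>2 \<eta>\<^sub>1 \<eta>\<^sub>2"
    and "bounded_in_space D\<^sub>1 u\<^sub>1" and "bounded_in_space D\<^sub>1 v\<^sub>1" and "bounded_in_space D\<^sub>1 w\<^sub>1"
    and "bounded_in_space D\<^sub>2 u\<^sub>2" and "bounded_in_space D\<^sub>2 v\<^sub>2" and "bounded_in_space D\<^sub>2 w\<^sub>2"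
  shows
    "(constant_vorticity D\<^sub>1 u\<^sub>1 v\<^sub>1 w\<^sub>1 \<and> constant_vorticity D\<^sub>2 u\<^sub>2 v\<^sub>2 w\<^sub>2 \<longleftrightarrow>
       (\<exists>U\<^sub>1 W\<^sub>1 U\<^sub>2 W\<^sub>2 :: real \<Rightarrow> real. \<forall>x y z t.
         ((x, y, z, t) \<in> D\<^sub>1 \<longrightarrow>
           u\<^sub>1 (x, y, z, t) = U\<^sub>1 t \<and> v\<^sub>1 (x, y, z, t) = 0 \<and> w\<^sub>1 (x, y, z, t) = W\<^sub>1 t) \<and>
         ((x, y, z, t) \<in> D\<^sub>2 \<longrightarrow>
           u\<^sub>2 (x, y, z, t) = U\<^sub>2 t \<and> v\<^sub>2 (x, y, z, t) = 0 \<and> w\<^sub>2 (x, y, z, t) = W\<^sub>2 t)))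
     \<and>
     (constant_vorticity D\<^sub>1 u\<^sub>1 v\<^sub>1 w\<^sub>1 \<and> constant_vorticity D\<^sub>2 u\<^sub>2 v\<^sub>2 w\<^sub>2 \<and>
      (\<exists>B :: real \<Rightarrow> real. \<forall>x y. b (x, y) = B y) \<and> bounded (range b) \<and>
      bounded_in_space D\<^sub>1 P\<^sub>1 \<and> bounded_in_space D\<^sub>2 P\<^sub>2 \<longrightarrow>
       (\<forall>q\<in>D\<^sub>1. u\<^sub>1 q = - (earth_rotation * earth_radius / 2) \<and> v\<^sub>1 q = 0 \<and> w\<^sub>1 q = 0) \<and>
       (\<forall>q\<in>D\<^sub>2. u\<^sub>2 q = - (earth_rotation * earth_radius / 2) \<and> v\<^sub>2 q = 0 \<and> w\<^sub>2 q = 0) \<and>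
       (\<rho>\<^sub>1 \<noteq> \<rho>\<^sub>2 \<longrightarrow>
         (\<exists>h c :: real. \<forall>x y t.
           \<eta>\<^sub>1 (x, y, t) = h \<and>
           \<eta>\<^sub>2 (x, y, t) = c - p (x + earth_rotation * earth_radius / 2 * t, y) / (\<rho>\<^sub>2 * g)) \<and>
         (pressure_normalized g \<rho>\<^sub>1 D\<^sub>1 P\<^sub>1 \<and> pressure_normalized g \<rho>\<^sub>2 D\<^sub>2 P\<^sub>2 \<longrightarrow>
           (\<forall>x y t.
             \<eta>\<^sub>1 (x, y, t) = 0 \<and>
             \<eta>\<^sub>2 (x, y, t) = - (p (x + earth_rotation * earth_radius / 2 * t, y) / (\<rho>\<^sub>2 * g))))))"
proof -
  note sol = assms(8)[unfolded two_layer_solution_def lower_layer_def upper_layer_def]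
  let ?lo = "\<lambda>(x, y, t :: real). b (x, y)"
  have D: "D\<^sub>1 = layer ?lo \<eta>\<^sub>1" "D\<^sub>2 = layer \<eta>\<^sub>1 \<eta>\<^sub>2"
    by (simp_all add: D\<^sub>1_def D\<^sub>2_def lower_layer_def upper_layer_def)
  have sm\<eta>: "smooth_in UNIV \<eta>\<^sub>1" "smooth_in UNIV \<eta>\<^sub>2"
    and order: "\<And>x y t. b (x, y) < \<eta>\<^sub>1 (x, y, t)" "\<And>x y t. \<eta>\<^sub>1 (x, y, t) < \<eta>\<^sub>2 (x, y, t)"
    and kin: "kinematic_condition \<eta>\<^sub>2 u\<^sub>2 v\<^sub>2 w\<^sub>2" "kinematic_condition \<eta>\<^sub>1 u\<^sub>2 v\<^sub>2 w\<^sub>2"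
      "kinematic_condition \<eta>\<^sub>1 u\<^sub>1 v\<^sub>1 w\<^sub>1"
    and bottom: "bottom_condition b u\<^sub>1 v\<^sub>1 w\<^sub>1"
    and interface: "\<And>x y t. P\<^sub>1 (x, y, \<eta>\<^sub>1 (x, y, t), t) = P\<^sub>2 (x, y, \<eta>\<^sub>1 (x, y, t), t)"
    and surface: "\<And>x y t. P\<^sub>2 (x, y, \<eta>\<^sub>2 (x, y, t), t) = p (x + drift_speed * t, y)"
    using sol by auto
  have sm\<^sub>1: "smooth_in (layer ?lo \<eta>\<^sub>1) u\<^sub>1" "smooth_in (layer ?lo \<eta>\<^sub>1) v\<^sub>1"
      "smooth_in (layer ?lo \<eta>\<^sub>1) w\<^sub>1" "smooth_in (layer ?lo \<eta>\<^sub>1) P\<^sub>1"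
    and sm\<^sub>2: "smooth_in (layer \<eta>\<^sub>1 \<eta>\<^sub>2) u\<^sub>2" "smooth_in (layer \<eta>\<^sub>1 \<eta>\<^sub>2) v\<^sub>2"
      "smooth_in (layer \<eta>\<^sub>1 \<eta>\<^sub>2) w\<^sub>2" "smooth_in (layer \<eta>\<^sub>1 \<eta>\<^sub>2) P\<^sub>2"
    and euler\<^sub>1: "euler_equations g \<rho>\<^sub>1 (layer ?lo \<eta>\<^sub>1) u\<^sub>1 v\<^sub>1 w\<^sub>1 P\<^sub>1"
    and euler\<^sub>2: "euler_equations g \<rho>\<^sub>2 (layer \<eta>\<^sub>1 \<eta>\<^sub>2) u\<^sub>2 v\<^sub>2 w\<^sub>2 P\<^sub>2"
    using sol by auto
  note bd = assms(9-14)[unfolded D]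
  have "continuous_on UNIV ?lo"
    using continuous_on_compose2[OF differentiable_imp_continuous_on[OF assms(6)],
        of UNIV "\<lambda>p :: real \<times> real \<times> real. (fst p, fst (snd p))"]
    by (simp add: case_prod_unfold continuous_intros)
  then interpret L\<^sub>1: fluid_layer ?lo \<eta>\<^sub>1
    using smooth_in_continuous_on[OF sm\<eta>(1)] order(1) by unfold_locales auto
  interpret L\<^sub>2: fluid_layer \<eta>\<^sub>1 \<eta>\<^sub>2
    using smooth_in_continuous_on[OF sm\<eta>(1)] smooth_in_continuous_on[OF sm\<eta>(2)] order(2)
    by unfold_locales auto
  let ?cv = "constant_vorticity D\<^sub>1 u\<^sub>1 v\<^sub>1 w\<^sub>1 \<and> constant_vorticity D\<^sub>2 u\<^sub>2 v\<^sub>2 w\<^sub>2"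

  have velocities: "\<exists>U\<^sub>1 W\<^sub>1 U\<^sub>2 W\<^sub>2. \<forall>x y z t.
      ((x, y, z, t) \<in> D\<^sub>1 \<longrightarrow>
        u\<^sub>1 (x, y, z, t) = U\<^sub>1 t \<and> v\<^sub>1 (x, y, z, t) = 0 \<and> w\<^sub>1 (x, y, z, t) = W\<^sub>1 t) \<and>
      ((x, y, z, t) \<in> D\<^sub>2 \<longrightarrow>
        u\<^sub>2 (x, y, z, t) = U\<^sub>2 t \<and> v\<^sub>2 (x, y, z, t) = 0 \<and> w\<^sub>2 (x, y, z, t) = W\<^sub>2 t)" if cv: ?cv
  proof -
    obtain U\<^sub>1 W\<^sub>1 where "\<And>x y z t. (x, y, z, t) \<in> D\<^sub>1 \<Longrightarrow>
        u\<^sub>1 (x, y, z, t) = U\<^sub>1 t \<and> v\<^sub>1 (x, y, z, t) = 0 \<and> w\<^sub>1 (x, y, z, t) = W\<^sub>1 t"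
      unfolding D
      using L\<^sub>1.constant_vorticity_velocity[OF sm\<^sub>1 euler\<^sub>1 cv[THEN conjunct1, unfolded D] bd(2,3)] by blast
    moreover obtain U\<^sub>2 W\<^sub>2 where "\<And>x y z t. (x, y, z, t) \<in> D\<^sub>2 \<Longrightarrow>
        u\<^sub>2 (x, y, z, t) = U\<^sub>2 t \<and> v\<^sub>2 (x, y, z, t) = 0 \<and> w\<^sub>2 (x, y, z, t) = W\<^sub>2 t"
      unfolding D
      using L\<^sub>2.constant_vorticity_velocity[OF sm\<^sub>2 euler\<^sub>2 cv[THEN conjunct2, unfolded D] bd(5,6)] by blast
    ultimately show ?thesis
      by blast
  qed
  have vorticities: ?cv if "\<exists>U\<^sub>1 W\<^sub>1 U\<^sub>2 W\<^sub>2 :: real \<Rightarrow> real. \<forall>x y z t.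
      ((x, y, z, t) \<in> D\<^sub>1 \<longrightarrow>
        u\<^sub>1 (x, y, z, t) = U\<^sub>1 t \<and> v\<^sub>1 (x, y, z, t) = 0 \<and> w\<^sub>1 (x, y, z, t) = W\<^sub>1 t) \<and>
      ((x, y, z, t) \<in> D\<^sub>2 \<longrightarrow>
        u\<^sub>2 (x, y, z, t) = U\<^sub>2 t \<and> v\<^sub>2 (x, y, z, t) = 0 \<and> w\<^sub>2 (x, y, z, t) = W\<^sub>2 t)"
    using that L\<^sub>1.time_dependent_constant_vorticity[OF sm\<^sub>1(1-3)]
      L\<^sub>2.time_dependent_constant_vorticity[OF sm\<^sub>2(1-3)] unfolding D by metis

  have rest: "(\<forall>q\<in>D\<^sub>1. u\<^sub>1 q = - drift_speed \<and> v\<^sub>1 q = 0 \<and> w\<^sub>1 q = 0) \<and>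
      (\<forall>q\<in>D\<^sub>2. u\<^sub>2 q = - drift_speed \<and> v\<^sub>2 q = 0 \<and> w\<^sub>2 q = 0) \<and>
      (\<rho>\<^sub>1 \<noteq> \<rho>\<^sub>2 \<longrightarrow>
        (\<exists>h c :: real. \<forall>x y t. \<eta>\<^sub>1 (x, y, t) = h \<and>
          \<eta>\<^sub>2 (x, y, t) = c - p (x + drift_speed * t, y) / (\<rho>\<^sub>2 * g)) \<and>
        (pressure_normalized g \<rho>\<^sub>1 D\<^sub>1 P\<^sub>1 \<and> pressure_normalized g \<rho>\<^sub>2 D\<^sub>2 P\<^sub>2 \<longrightarrow>
          (\<forall>x y t. \<eta>\<^sub>1 (x, y, t) = 0 \<and>
            \<eta>\<^sub>2 (x, y, t) = - (p (x + drift_speed * t, y) / (\<rho>\<^sub>2 * g)))))"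
    if cv: ?cv and b: "\<exists>B :: real \<Rightarrow> real. \<forall>x y. b (x, y) = B y" "bounded (range b)"
      and bdP: "bounded_in_space D\<^sub>1 P\<^sub>1" "bounded_in_space D\<^sub>2 P\<^sub>2"
  proof -
    note bdP = bdP[unfolded D]
    obtain U\<^sub>1 W\<^sub>1 U\<^sub>2 W\<^sub>2 where
      vel\<^sub>1: "\<And>x y z t. (x, y, z, t) \<in> layer ?lo \<eta>\<^sub>1 \<Longrightarrow>
        u\<^sub>1 (x, y, z, t) = U\<^sub>1 t \<and> v\<^sub>1 (x, y, z, t) = 0 \<and> w\<^sub>1 (x, y, z, t) = W\<^sub>1 t" and
      vel\<^sub>2: "\<And>x y z t. (x, y, z, t) \<in> layer \<eta>\<^sub>1 \<eta>\<^sub>2 \<Longrightarrow>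
        u\<^sub>2 (x, y, z, t) = U\<^sub>2 t \<and> v\<^sub>2 (x, y, z, t) = 0 \<and> w\<^sub>2 (x, y, z, t) = W\<^sub>2 t"
      using velocities[OF cv] unfolding D by blast
    have on_bottom: "(x, y, b (x, y), t) \<in> layer ?lo \<eta>\<^sub>1"
      and on_interface\<^sub>1: "(x, y, \<eta>\<^sub>1 (x, y, t), t) \<in> layer ?lo \<eta>\<^sub>1"
      and on_interface\<^sub>2: "(x, y, \<eta>\<^sub>1 (x, y, t), t) \<in> layer \<eta>\<^sub>1 \<eta>\<^sub>2"
      and on_surface: "(x, y, \<eta>\<^sub>2 (x, y, t), t) \<in> layer \<eta>\<^sub>1 \<eta>\<^sub>2" for x y t
      using order[of x y t] by (simp_all add: L\<^sub>1.mem_layer L\<^sub>2.mem_layer)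
    have W\<^sub>1: "W\<^sub>1 t = 0" for t
      using bottom_condition_x_independent[OF bottom assms(6)] b(1) vel\<^sub>1[OF on_bottom, of 0 0 t]
      by auto
    obtain M where "\<And>x y. \<bar>b (x, y)\<bar> \<le> M"
      using b(2) unfolding bounded_iff by auto
    then have U\<^sub>1: "U\<^sub>1 t = - drift_speed" for t
      using L\<^sub>1.bounded_pressure_drift[OF sm\<^sub>1 euler\<^sub>1 assms(4) vel\<^sub>1 bdP(1), of t M] by simp
    have drift\<^sub>1: "u\<^sub>1 q = - drift_speed \<and> v\<^sub>1 q = 0 \<and> w\<^sub>1 q = 0" if "q \<in> layer ?lo \<eta>\<^sub>1" for q
      using vel\<^sub>1 that U\<^sub>1 W\<^sub>1 by (cases q) auto
    obtain f\<^sub>1 where f\<^sub>1: "\<And>x y z t. (x, y, z, t) \<in> layer ?lo \<eta>\<^sub>1 \<Longrightarrow> P\<^sub>1 (x, y, z, t) = f\<^sub>1 t - \<rho>\<^sub>1 * g * z"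
      using L\<^sub>1.drift_hydrostatic_pressure[OF sm\<^sub>1 euler\<^sub>1 assms(4) drift\<^sub>1] by blast
    have U\<^sub>2: "U\<^sub>2 t = - drift_speed" for t
    proof -
      obtain M where M: "\<And>x y. \<bar>\<eta>\<^sub>1 (x, y, t)\<bar> \<le> M"
        using L\<^sub>1.hydrostatic_bounded_upper_surface[OF bdP(1) f\<^sub>1 assms(4,3)] by blast
      show ?thesis
        by (rule L\<^sub>2.bounded_pressure_drift[OF sm\<^sub>2 euler\<^sub>2 assms(5) vel\<^sub>2 bdP(2) M])
    qed
    \<comment> \<open>Both kinematic conditions at the interface have the same right-hand side once
      the horizontal velocities agree, so the vertical velocities agree too.\<close>
    have W\<^sub>2: "W\<^sub>2 t = 0" for t
      using kin(2,3)[unfolded kinematic_condition_def Let_def, rule_format, of 0 0 t]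
        vel\<^sub>1[OF on_interface\<^sub>1[of 0 0 t]] vel\<^sub>2[OF on_interface\<^sub>2[of 0 0 t]] U\<^sub>1 U\<^sub>2 W\<^sub>1 by simp
    have drift\<^sub>2: "u\<^sub>2 q = - drift_speed \<and> v\<^sub>2 q = 0 \<and> w\<^sub>2 q = 0" if "q \<in> layer \<eta>\<^sub>1 \<eta>\<^sub>2" for q
      using vel\<^sub>2 that U\<^sub>2 W\<^sub>2 by (cases q) auto
    obtain f\<^sub>2 where f\<^sub>2: "\<And>x y z t. (x, y, z, t) \<in> layer \<eta>\<^sub>1 \<eta>\<^sub>2 \<Longrightarrow> P\<^sub>2 (x, y, z, t) = f\<^sub>2 t - \<rho>\<^sub>2 * g * z"
      using L\<^sub>2.drift_hydrostatic_pressure[OF sm\<^sub>2 euler\<^sub>2 assms(5) drift\<^sub>2] by blast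
    have wave: "\<eta>\<^sub>1 (x, y, t) = \<eta>\<^sub>1 (x + drift_speed * t, y, 0)"
      "\<eta>\<^sub>2 (x, y, t) = \<eta>\<^sub>2 (x + drift_speed * t, y, 0)" for x y t
      using kinematic_condition_travelling[OF kin(2) smooth_in_differentiable_on[OF sm\<eta>(1)] drift\<^sub>2[OF on_interface\<^sub>2]]
        kinematic_condition_travelling[OF kin(1) smooth_in_differentiable_on[OF sm\<eta>(2)] drift\<^sub>2[OF on_surface]]
      by simp_all
    have surface_eq: "f\<^sub>2 t - \<rho>\<^sub>2 * g * \<eta>\<^sub>2 (x, y, t) = p (x + drift_speed * t, y)" for x y t
      using f\<^sub>2[OF on_surface] surface by simp
    \<comment> \<open>The point x = - drift_speed * t moves with the wave: it sees the fixed surface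
      pressure p(0, 0) and a fixed surface height.\<close>
    have f\<^sub>2_const: "f\<^sub>2 t = f\<^sub>2 0" for t
      using surface_eq[of t "- drift_speed * t" 0] surface_eq[of 0 0 0] wave(2)[of "- drift_speed * t" 0 t]
      by simp
    have \<eta>\<^sub>2: "\<eta>\<^sub>2 (x, y, t) = f\<^sub>2 0 / (\<rho>\<^sub>2 * g) - p (x + drift_speed * t, y) / (\<rho>\<^sub>2 * g)" for x y t
      using surface_eq[of t x y, symmetric] assms(3,5) f\<^sub>2_const[of t] by (simp add: diff_divide_distrib)
    have jump: "(\<rho>\<^sub>1 - \<rho>\<^sub>2) * g * \<eta>\<^sub>1 (x, y, t) = f\<^sub>1 t - f\<^sub>2 t" for x y t
      using f\<^sub>1[OF on_interface\<^sub>1, of x y t] f\<^sub>2[OF on_interface\<^sub>2, of x y t] interface[of x y t]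
      by (simp add: algebra_simps)
    have "\<exists>h c :: real. \<forall>x y t. \<eta>\<^sub>1 (x, y, t) = h \<and>
        \<eta>\<^sub>2 (x, y, t) = c - p (x + drift_speed * t, y) / (\<rho>\<^sub>2 * g)" if "\<rho>\<^sub>1 \<noteq> \<rho>\<^sub>2"
    proof -
      \<comment> \<open>Following the wave back to time 0 turns the time-dependent right-hand side
        of \<open>jump\<close> into a single number.\<close>
      have "\<eta>\<^sub>1 (x, y, t) = (f\<^sub>1 0 - f\<^sub>2 0) / ((\<rho>\<^sub>1 - \<rho>\<^sub>2) * g)" for x y t
        using wave(1)[of x y t] jump[of "x + drift_speed * t" y 0] that assms(3)
        by (simp add: eq_divide_eq mult.commute)
      with \<eta>\<^sub>2 show ?thesis
        by blast
    qed
    moreover have "\<eta>\<^sub>1 (x, y, t) = 0 \<and> \<eta>\<^sub>2 (x, y, t) = - (p (x + drift_speed * t, y) / (\<rho>\<^sub>2 * g))"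
      if "\<rho>\<^sub>1 \<noteq> \<rho>\<^sub>2" and norm: "pressure_normalized g \<rho>\<^sub>1 D\<^sub>1 P\<^sub>1" "pressure_normalized g \<rho>\<^sub>2 D\<^sub>2 P\<^sub>2" for x y t
    proof -
      \<comment> \<open>At the point of normalization the hydrostatic law leaves no room for the
        additive function of time; this gives its vanishing at one time only.\<close>
      obtain s where "f\<^sub>1 s = 0"
        using norm(1) f\<^sub>1 unfolding pressure_normalized_def D by fastforce
      obtain s' where "f\<^sub>2 s' = 0"
        using norm(2) f\<^sub>2 unfolding pressure_normalized_def D by fastforce
      then have f\<^sub>2_0: "f\<^sub>2 r = 0" for r
        using f\<^sub>2_const by metis
      \<comment> \<open>The wave is followed to the time s, the only one at which
        \<open>f\<^sub>1\<close> is known to vanish.\<close>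
      have "\<eta>\<^sub>1 (x, y, t) = \<eta>\<^sub>1 (x + drift_speed * t - drift_speed * s, y, s)"
        using wave(1)[of x y t] wave(1)[of "x + drift_speed * t - drift_speed * s" y s] by simp
      then have "\<eta>\<^sub>1 (x, y, t) = 0"
        using jump[of "x + drift_speed * t - drift_speed * s" y s] \<open>f\<^sub>1 s = 0\<close> f\<^sub>2_0 that(1) assms(3) by simp
      then show ?thesis
        using \<eta>\<^sub>2 f\<^sub>2_0 by simp
    qed
    ultimately show ?thesis
      using drift\<^sub>1 drift\<^sub>2 unfolding D by blast
  qed
  show ?thesis
    using velocities vorticities rest by blast
qed

end
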